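(* A rotation surface $\psi:\mathbb{R}^2\supseteq D^2\to H^2\times\mathbb{R}$, $$\psi(r,\theta)=(\cosh k(r),\ \sinh k(r)\cos\theta,\ \sinh k(r)\sin\theta,\ h(r)),$$ with (i) $\Delta k=0$ or (ii) $K=0$, is biharmonic if and only if it is minimal.
   Context: $H^2$ is the hyperboloid model of the hyperbolic plane of curvature $-1$ in Minkowski space $\mathbb{L}^3$, $H^2\times\mathbb{R}$ carries the product metric, and $k,h$ are smooth functions of $r$. $\Delta$ is the Laplacian (trace of the Hessian) and $K$ the Gauss curvature of the surface with respect to the induced metric; $k$ is regarded as a function on the surface. A surface is biharmonic if its defining isometric immersion is a biharmonic map (critical point of the bienergy $\frac12\int|\tau|^2$, $\tau$ the tension field), and minimal if its mean curvature vanishes identically. *)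

theory Defs
  imports "HOL-Analysis.Analysis"
begin

primrec higher_differentiable_on ::
    "'a::real_normed_vector set \<Rightarrow> ('a \<Rightarrow> 'b::real_normed_vector) \<Rightarrow> nat \<Rightarrow> bool" where
  "higher_differentiable_on S f 0 \<longleftrightarrow> continuous_on S f"
| "higher_differentiable_on S f (Suc n) \<longleftrightarrow>
     (\<forall>x\<in>S. f differentiable (at x)) \<and>
     (\<forall>v. higher_differentiable_on S (\<lambda>x. frechet_derivative f (at x) v) n)"

text \<open>\<open>C\<^sup>\<infinity>\<close> on an open set \<open>S\<close>; the derivatives are two-sided, so the notion is only used for open sets.\<close>

definition smooth_on ::
    "'a::real_normed_vector set \<Rightarrow> ('a \<Rightarrow> 'b::real_normed_vector) \<Rightarrow> bool" where
  "smooth_on S f \<longleftrightarrow> (\<forall>n. higher_differentiable_on S f n)"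

definition partial_deriv ::
    "'n::finite \<Rightarrow> (real^'n \<Rightarrow> 'b::real_normed_vector) \<Rightarrow> real^'n \<Rightarrow> 'b" where
  "partial_deriv i f x = vector_derivative (\<lambda>t. f (x + t *\<^sub>R axis i 1)) (at 0)"

text \<open>A metric is given by its coefficient matrices \<open>g x $ i $ j = g\<^sub>i\<^sub>j(x)\<close>;
  \<open>christoffel g k i j\<close> is \<open>\<Gamma>\<^sup>k\<^sub>i\<^sub>j\<close>.\<close>

definition christoffel ::
    "(real^'n \<Rightarrow> real^'n^'n) \<Rightarrow> 'n \<Rightarrow> 'n \<Rightarrow> 'n \<Rightarrow> real^'n::finite \<Rightarrow> real" where
  "christoffel g k i j x = (\<Sum>l\<in>UNIV. matrix_inv (g x) $ k $ l *
     (partial_deriv i (\<lambda>y. g y $ j $ l) x + partial_deriv j (\<lambda>y. g y $ i $ l) x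
       - partial_deriv l (\<lambda>y. g y $ i $ j) x)) / 2"

definition hessian ::
    "(real^'n \<Rightarrow> real^'n^'n) \<Rightarrow> (real^'n::finite \<Rightarrow> real) \<Rightarrow> 'n \<Rightarrow> 'n \<Rightarrow> real^'n \<Rightarrow> real" where
  "hessian g f i j x = partial_deriv i (partial_deriv j f) x
     - (\<Sum>k\<in>UNIV. christoffel g k i j x * partial_deriv k f x)"

definition laplacian ::
    "(real^'n \<Rightarrow> real^'n^'n) \<Rightarrow> (real^'n::finite \<Rightarrow> real) \<Rightarrow> real^'n \<Rightarrow> real" where
  "laplacian g f x = (\<Sum>i\<in>UNIV. \<Sum>j\<in>UNIV. matrix_inv (g x) $ i $ j * hessian g f i j x)"

text \<open>\<open>riemann g l k i j\<close> is the coefficient of \<open>\<partial>\<^sub>l\<close> in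
  \<open>R(\<partial>\<^sub>i,\<partial>\<^sub>j)\<partial>\<^sub>k\<close>, where \<open>R(X,Y) = \<nabla>\<^sub>X\<nabla>\<^sub>Y - \<nabla>\<^sub>Y\<nabla>\<^sub>X - \<nabla>\<^bsub>[X,Y]\<^esub>\<close>.\<close>

definition riemann ::
    "(real^'n \<Rightarrow> real^'n^'n) \<Rightarrow> 'n \<Rightarrow> 'n \<Rightarrow> 'n \<Rightarrow> 'n \<Rightarrow> real^'n::finite \<Rightarrow> real" where
  "riemann g l k i j x =
     partial_deriv i (christoffel g l j k) x - partial_deriv j (christoffel g l i k) x
     + (\<Sum>m\<in>UNIV. christoffel g l i m x * christoffel g m j k x
                  - christoffel g l j m x * christoffel g m i k x)"

text \<open>\<open>K = g(R(\<partial>\<^sub>1,\<partial>\<^sub>2)\<partial>\<^sub>2, \<partial>\<^sub>1) / det g\<close>.\<close>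

definition gauss_curvature :: "(real^2 \<Rightarrow> real^2^2) \<Rightarrow> real^2 \<Rightarrow> real" where
  "gauss_curvature g x = (\<Sum>l\<in>UNIV. g x $ 1 $ l * riemann g l 2 1 2 x) / det (g x)"

definition mink :: "real^3 \<Rightarrow> real^3 \<Rightarrow> real" where
  "mink v w = - (v $ 1 * w $ 1) + v $ 2 * w $ 2 + v $ 3 * w $ 3"

definition hyperboloid :: "(real^3) set" where
  "hyperboloid = {v. mink v v = -1 \<and> v $ 1 > 0}"

definition H2R :: "((real^3) \<times> real) set" where
  "H2R = hyperboloid \<times> UNIV"

text \<open>The product scalar product of \<open>\<L>\<^sup>3 \<times> \<real>\<close>; on tangent vectors of \<open>H2R\<close> it is the
  Riemannian product metric.\<close>

definition ip :: "(real^3) \<times> real \<Rightarrow> (real^3) \<times> real \<Rightarrow> real" where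
  "ip v w = mink (fst v) (fst w) + snd v * snd w"

text \<open>Orthogonal projection onto the tangent space of \<open>H2R\<close> at \<open>p\<close>; the normal direction
  \<open>(fst p, 0)\<close> satisfies \<open>mink (fst p) (fst p) = -1\<close>, hence the plus sign.\<close>

definition tangent_proj :: "(real^3) \<times> real \<Rightarrow> (real^3) \<times> real \<Rightarrow> (real^3) \<times> real" where
  "tangent_proj p v = (fst v + mink (fst v) (fst p) *\<^sub>R fst p, snd v)"

text \<open>The Levi-Civita derivative \<open>\<nabla>\<^bsub>\<partial>\<^sub>i\<^esub> V\<close> of a vector field \<open>V\<close> along \<open>\<phi>\<close>:
  the tangential part of the flat derivative.\<close>

definition cov_deriv ::
    "(real^'n \<Rightarrow> (real^3) \<times> real) \<Rightarrow> 'n \<Rightarrow> (real^'n::finite \<Rightarrow> (real^3) \<times> real) \<Rightarrow> real^'n \<Rightarrow> (real^3) \<times> real" where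
  "cov_deriv \<phi> i V x = tangent_proj (\<phi> x) (partial_deriv i V x)"

definition induced_metric ::
    "(real^'n::finite \<Rightarrow> (real^3) \<times> real) \<Rightarrow> real^'n \<Rightarrow> real^'n^'n" where
  "induced_metric \<phi> x = (\<chi> i j. ip (partial_deriv i \<phi> x) (partial_deriv j \<phi> x))"

definition immersion_on ::
    "(real^'n::finite) set \<Rightarrow> (real^'n \<Rightarrow> (real^3) \<times> real) \<Rightarrow> bool" where
  "immersion_on D \<phi> \<longleftrightarrow> smooth_on D \<phi> \<and> \<phi> ` D \<subseteq> H2R \<and>
     (\<forall>x\<in>D. inj (frechet_derivative \<phi> (at x)))"

text \<open>The second fundamental form \<open>B(\<partial>\<^sub>i,\<partial>\<^sub>j)\<close>: the component of \<open>\<nabla>\<^bsub>\<partial>\<^sub>i\<^esub> d\<phi>(\<partial>\<^sub>j)\<close>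
  orthogonal to the image of \<open>d\<phi>\<close>.\<close>

definition second_fundamental_form ::
    "(real^'n::finite \<Rightarrow> (real^3) \<times> real) \<Rightarrow> 'n \<Rightarrow> 'n \<Rightarrow> real^'n \<Rightarrow> (real^3) \<times> real" where
  "second_fundamental_form \<phi> i j x =
     cov_deriv \<phi> i (partial_deriv j \<phi>) x
     - (\<Sum>k\<in>UNIV. \<Sum>l\<in>UNIV. (matrix_inv (induced_metric \<phi> x) $ k $ l *
          ip (cov_deriv \<phi> i (partial_deriv j \<phi>) x) (partial_deriv k \<phi> x)) *\<^sub>R partial_deriv l \<phi> x)"

definition mean_curvature_vector ::
    "(real^'n::finite \<Rightarrow> (real^3) \<times> real) \<Rightarrow> real^'n \<Rightarrow> (real^3) \<times> real" where
  "mean_curvature_vector \<phi> x = (1 / real CARD('n)) *\<^sub>R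
     (\<Sum>i\<in>UNIV. \<Sum>j\<in>UNIV. matrix_inv (induced_metric \<phi> x) $ i $ j *\<^sub>R second_fundamental_form \<phi> i j x)"

definition minimal_on ::
    "(real^'n::finite) set \<Rightarrow> (real^'n \<Rightarrow> (real^3) \<times> real) \<Rightarrow> bool" where
  "minimal_on D \<phi> \<longleftrightarrow> (\<forall>x\<in>D. mean_curvature_vector \<phi> x = 0)"

text \<open>\<open>\<tau>(\<phi>) = trace\<^sub>g \<nabla>d\<phi>\<close>; the metric \<open>g\<close> on the domain is independent of \<open>\<phi>\<close>.\<close>

definition tension ::
    "(real^'n \<Rightarrow> real^'n^'n) \<Rightarrow> (real^'n::finite \<Rightarrow> (real^3) \<times> real) \<Rightarrow> real^'n \<Rightarrow> (real^3) \<times> real" where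
  "tension g \<phi> x = (\<Sum>i\<in>UNIV. \<Sum>j\<in>UNIV. matrix_inv (g x) $ i $ j *\<^sub>R
     (cov_deriv \<phi> i (partial_deriv j \<phi>) x
       - (\<Sum>k\<in>UNIV. christoffel g k i j x *\<^sub>R partial_deriv k \<phi> x)))"

definition bienergy ::
    "(real^'n \<Rightarrow> real^'n^'n) \<Rightarrow> (real^'n::finite) set \<Rightarrow> (real^'n \<Rightarrow> (real^3) \<times> real) \<Rightarrow> real" where
  "bienergy g C \<phi> =
     (\<integral>x\<in>C. ip (tension g \<phi> x) (tension g \<phi> x) * sqrt (det (g x)) \<partial>lborel) / 2"

text \<open>A smooth variation \<open>\<Phi>\<^sub>t\<close>, \<open>\<bar>t\<bar> < \<epsilon>\<close>, of \<open>\<phi>\<close> through maps into \<open>H2R\<close> that is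
  supported in the compact set \<open>C\<close>.\<close>

definition compact_variation ::
    "(real^'n::finite) set \<Rightarrow> (real^'n \<Rightarrow> (real^3) \<times> real) \<Rightarrow> real \<Rightarrow> (real^'n) set
      \<Rightarrow> (real \<Rightarrow> real^'n \<Rightarrow> (real^3) \<times> real) \<Rightarrow> bool" where
  "compact_variation D \<phi> \<epsilon> C \<Phi> \<longleftrightarrow>
     \<epsilon> > 0 \<and> compact C \<and> C \<subseteq> D \<and>
     smooth_on ({-\<epsilon><..<\<epsilon>} \<times> D) (\<lambda>(t, x). \<Phi> t x) \<and>
     (\<forall>t\<in>{-\<epsilon><..<\<epsilon>}. \<forall>x\<in>D. \<Phi> t x \<in> H2R) \<and>
     (\<forall>x\<in>D. \<Phi> 0 x = \<phi> x) \<and>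
     (\<forall>t\<in>{-\<epsilon><..<\<epsilon>}. \<forall>x\<in>D - C. \<Phi> t x = \<phi> x)"

definition biharmonic_on ::
    "(real^'n::finite) set \<Rightarrow> (real^'n \<Rightarrow> real^'n^'n) \<Rightarrow> (real^'n \<Rightarrow> (real^3) \<times> real) \<Rightarrow> bool" where
  "biharmonic_on D g \<phi> \<longleftrightarrow> smooth_on D \<phi> \<and> \<phi> ` D \<subseteq> H2R \<and>
     (\<forall>\<epsilon> C \<Phi>. compact_variation D \<phi> \<epsilon> C \<Phi> \<longrightarrow>
        ((\<lambda>t. bienergy g C (\<Phi> t)) has_real_derivative 0) (at 0))"

text \<open>The coordinates \<open>(r, \<theta>)\<close> are \<open>(x $ 1, x $ 2)\<close>.\<close>

definition rotation_surface ::
    "(real \<Rightarrow> real) \<Rightarrow> (real \<Rightarrow> real) \<Rightarrow> real^2 \<Rightarrow> (real^3) \<times> real" where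
  "rotation_surface k h x =
     (vector [cosh (k (x $ 1)), sinh (k (x $ 1)) * cos (x $ 2), sinh (k (x $ 1)) * sin (x $ 2)],
      h (x $ 1))"

end

theory Submission
  imports Defs
begin

text \<open>Write \<open>U = k'\<^sup>2 + h'\<^sup>2\<close> and \<open>F = sinh\<^sup>2 k\<close> for the coefficients of the induced metric
  \<open>U dr\<^sup>2 + F d\<theta>\<^sup>2\<close>, and \<open>S = sinh k\<close>, \<open>C = cosh k\<close>. The component of the tension field in the direction
  of the unit radial field of \<open>H\<^sup>2\<close> is \<open>T = \<Delta>k - C/S\<close>. Varying \<open>k\<close> to \<open>k + t\<alpha>\<close>, with \<open>\<alpha>\<close> a bump function
  on \<open>D\<close>, and integrating by parts shows that a biharmonic rotation surface satisfies
  \<open>\<Delta>T = (1 + 2 S\<^sup>2) / S\<^sup>2 * T\<close> (lemmas \<open>weak_radial_equation\<close> and \<open>biharmonic_radial_equation\<close>). A minimal one satisfies it as well,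
  because then \<open>T = 0\<close> (\<open>minimal_imp_radial_tension_0\<close>). The point of the theorem is that neither curvature
  condition leaves room for a solution of this single equation:

  \<^item> If \<open>\<Delta>k = 0\<close>, then \<open>T = - C/S\<close> and the equation reads \<open>2 k'\<^sup>2 = (1 + 2 S\<^sup>2) U\<close>. Differentiating this
    and inserting \<open>\<Delta>k = 0\<close> once more yields \<open>4 S\<^sup>2 + 1 = 0\<close>.

  \<^item> If \<open>K = 0\<close>, then \<open>m = ((sinh k)')\<^sup>2 / U\<close> has vanishing derivative (in arc length, \<open>sinh k\<close> is affine),
    \<open>T = - C/S + m / (S C\<^sup>3)\<close>, and the equation turns into the sum of squares
    \<open>(1 + 2 S\<^sup>2) (C\<^sup>4 - m)\<^sup>2 + 16 m\<^sup>2 S\<^sup>4 = 0\<close>. Since \<open>S \<noteq> 0\<close>, it forces first \<open>m = 0\<close> and then \<open>C = 0\<close>.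

  So over a nonempty \<open>D\<close> the surface is neither biharmonic nor minimal, and over the empty set it is both.

  The analytic input is elementary: the existence of smooth bump functions, differentiation under the
  integral sign, and the vanishing of the integral of a partial derivative of a compactly supported
  function, which follows from translation invariance.\<close>

section \<open>Smooth functions\<close>

lemma higher_differentiable_on_cong:
  assumes "open S" "\<And>x. x \<in> S \<Longrightarrow> f x = g x"
  shows "higher_differentiable_on S f n \<longleftrightarrow> higher_differentiable_on S g n"
  using assms(2)
proof (induction n arbitrary: f g)
  case 0
  then show ?case by (auto cong: continuous_on_cong)
next
  case (Suc n)
  have diff: "f differentiable (at x) \<longleftrightarrow> g differentiable (at x)" if "x \<in> S" for x
    using that Suc.prems assms(1) has_derivative_transform_within_open[of f _ x UNIV S g]
      has_derivative_transform_within_open[of g _ x UNIV S f]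
    unfolding differentiable_def by auto
  show ?case
  proof (cases "\<forall>x\<in>S. f differentiable (at x)")
    case True
    have "higher_differentiable_on S (\<lambda>x. frechet_derivative f (at x) v) n
      \<longleftrightarrow> higher_differentiable_on S (\<lambda>x. frechet_derivative g (at x) v) n" for v
      by (rule Suc.IH) (use True assms(1) Suc.prems in \<open>auto simp: frechet_derivative_transform_within_open[of f _ S g]\<close>)
    then show ?thesis using diff by auto
  next
    case False
    then show ?thesis using diff by auto
  qed
qed

lemma smooth_on_cong:
  "open S \<Longrightarrow> (\<And>x. x \<in> S \<Longrightarrow> f x = g x) \<Longrightarrow> smooth_on S f \<longleftrightarrow> smooth_on S g"
  unfolding smooth_on_def using higher_differentiable_on_cong[of S f g] by auto

lemma higher_differentiable_on_SucI:
  assumes "open S" "\<And>x. x \<in> S \<Longrightarrow> (f has_derivative f' x) (at x)"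
    and "\<And>v. higher_differentiable_on S (\<lambda>x. f' x v) n"
  shows "higher_differentiable_on S f (Suc n)"
proof -
  have "higher_differentiable_on S (\<lambda>x. frechet_derivative f (at x) v) n" for v
    using assms(3)[of v]
    by (subst higher_differentiable_on_cong[OF assms(1), where g="\<lambda>x. f' x v"])
       (simp_all add: frechet_derivative_at[OF assms(2), symmetric])
  with assms(2) show ?thesis by (auto simp: differentiable_def)
qed

lemma higher_differentiable_on_Suc_has_derivative:
  "higher_differentiable_on S f (Suc n) \<Longrightarrow> x \<in> S
    \<Longrightarrow> (f has_derivative frechet_derivative f (at x)) (at x)"
  by (simp add: frechet_derivative_works[symmetric])

lemma higher_differentiable_on_Suc_imp:
  "higher_differentiable_on S f (Suc n) \<Longrightarrow> higher_differentiable_on S f n"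
proof (induction n arbitrary: f)
  case 0
  then show ?case
    by (auto intro!: continuous_at_imp_continuous_on differentiable_imp_continuous_within)
qed simp

lemma higher_differentiable_on_subset:
  "higher_differentiable_on S f n \<Longrightarrow> T \<subseteq> S \<Longrightarrow> higher_differentiable_on T f n"
  by (induction n arbitrary: f) (auto intro: continuous_on_subset)

lemma higher_differentiable_on_const: "higher_differentiable_on S (\<lambda>x. c) n"
  by (induction n arbitrary: c) auto

lemma higher_differentiable_on_linear:
  assumes "open S" "bounded_linear L"
  shows "higher_differentiable_on S L n"
proof (cases n)
  case 0
  then show ?thesis using assms(2) by (auto intro: linear_continuous_on)
next
  case (Suc m)
  show ?thesis unfolding Suc
    by (rule higher_differentiable_on_SucI[OF assms(1), where f'="\<lambda>_. L"])
       (simp_all add: bounded_linear_imp_has_derivative assms(2) higher_differentiable_on_const)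
qed

lemma higher_differentiable_on_add:
  assumes "open S" "higher_differentiable_on S f n" "higher_differentiable_on S g n"
  shows "higher_differentiable_on S (\<lambda>x. f x + g x) n"
  using assms(2,3)
proof (induction n arbitrary: f g)
  case 0
  then show ?case by (simp add: continuous_on_scaleR continuous_on_add)
next
  case (Suc n)
  show ?case
    by (rule higher_differentiable_on_SucI[OF assms(1), where
          f'="\<lambda>x v. frechet_derivative f (at x) v + frechet_derivative g (at x) v"])
       (use Suc in \<open>simp_all add: has_derivative_add higher_differentiable_on_Suc_has_derivative\<close>)
qed

lemma higher_differentiable_on_scaleR:
  fixes f :: "'a::real_normed_vector \<Rightarrow> real"
  assumes "open S" "higher_differentiable_on S f n" "higher_differentiable_on S g n"
  shows "higher_differentiable_on S (\<lambda>x. f x *\<^sub>R g x) n"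
  using assms(2,3)
proof (induction n arbitrary: f g)
  case 0
  then show ?case by (simp add: continuous_on_scaleR continuous_on_add)
next
  case (Suc n)
  note low = Suc.prems[THEN higher_differentiable_on_Suc_imp]
  show ?case
  proof (rule higher_differentiable_on_SucI[OF assms(1), where
        f'="\<lambda>x v. f x *\<^sub>R frechet_derivative g (at x) v + frechet_derivative f (at x) v *\<^sub>R g x"])
    show "((\<lambda>x. f x *\<^sub>R g x) has_derivative
      (\<lambda>v. f x *\<^sub>R frechet_derivative g (at x) v + frechet_derivative f (at x) v *\<^sub>R g x)) (at x)"
      if "x \<in> S" for x
      by (rule has_derivative_scaleR[OF Suc.prems[THEN higher_differentiable_on_Suc_has_derivative, OF that]])
    show "higher_differentiable_on S
      (\<lambda>x. f x *\<^sub>R frechet_derivative g (at x) v + frechet_derivative f (at x) v *\<^sub>R g x) n" for v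
      by (rule higher_differentiable_on_add[OF assms(1)]; rule Suc.IH; use Suc.prems low in simp)
  qed
qed

lemma higher_differentiable_on_compose:
  fixes g :: "real \<Rightarrow> 'b::real_normed_vector"
  assumes "open S" "open T" "f ` S \<subseteq> T"
    and "higher_differentiable_on T g n" "higher_differentiable_on S f n"
  shows "higher_differentiable_on S (\<lambda>x. g (f x)) n"
  using assms(4,5)
proof (induction n arbitrary: g)
  case 0
  then show ?case using assms(3) continuous_on_compose2[of T g S f] by simp
next
  case (Suc n)
  let ?g' = "\<lambda>y. frechet_derivative g (at y) 1"
  show ?case
  proof (rule higher_differentiable_on_SucI[OF assms(1), where
        f'="\<lambda>x v. frechet_derivative f (at x) v *\<^sub>R ?g' (f x)"])
    fix x assume x: "x \<in> S"
    have g: "(g has_derivative frechet_derivative g (at (f x))) (at (f x))"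
      and f: "(f has_derivative frechet_derivative f (at x)) (at x)"
      using x assms(3) higher_differentiable_on_Suc_has_derivative[OF Suc.prems(1)]
        higher_differentiable_on_Suc_has_derivative[OF Suc.prems(2)] by auto
    have eq: "(\<lambda>v. frechet_derivative g (at (f x)) (frechet_derivative f (at x) v))
      = (\<lambda>v. frechet_derivative f (at x) v *\<^sub>R ?g' (f x))"
    proof
      show "frechet_derivative g (at (f x)) (frechet_derivative f (at x) v)
        = frechet_derivative f (at x) v *\<^sub>R ?g' (f x)" for v
        using linear_scale[OF has_derivative_linear[OF g], of "frechet_derivative f (at x) v" 1] by simp
    qed
    show "((\<lambda>x. g (f x)) has_derivative (\<lambda>v. frechet_derivative f (at x) v *\<^sub>R ?g' (f x))) (at x)"
      using has_derivative_compose[OF f g] unfolding eq .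
  next
    show "higher_differentiable_on S (\<lambda>x. frechet_derivative f (at x) v *\<^sub>R ?g' (f x)) n" for v
      by (rule higher_differentiable_on_scaleR[OF assms(1) _ Suc.IH])
         (use Suc.prems higher_differentiable_on_Suc_imp in simp_all)
  qed
qed

lemma smooth_on_add:
  "open S \<Longrightarrow> smooth_on S f \<Longrightarrow> smooth_on S g \<Longrightarrow> smooth_on S (\<lambda>x. f x + g x)"
  by (simp add: smooth_on_def higher_differentiable_on_add)

lemma smooth_on_scaleR:
  fixes f :: "'a::real_normed_vector \<Rightarrow> real"
  shows "open S \<Longrightarrow> smooth_on S f \<Longrightarrow> smooth_on S g \<Longrightarrow> smooth_on S (\<lambda>x. f x *\<^sub>R g x)"
  by (simp add: smooth_on_def higher_differentiable_on_scaleR)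

lemma smooth_on_mult:
  fixes f g :: "'a::real_normed_vector \<Rightarrow> real"
  shows "open S \<Longrightarrow> smooth_on S f \<Longrightarrow> smooth_on S g \<Longrightarrow> smooth_on S (\<lambda>x. f x * g x)"
  using smooth_on_scaleR[of S f g] by simp

lemma smooth_on_const: "smooth_on S (\<lambda>x. c)"
  by (simp add: smooth_on_def higher_differentiable_on_const)

lemma smooth_on_linear: "open S \<Longrightarrow> bounded_linear L \<Longrightarrow> smooth_on S L"
  by (simp add: smooth_on_def higher_differentiable_on_linear)

lemma smooth_on_compose:
  fixes g :: "real \<Rightarrow> 'b::real_normed_vector"
  shows "open S \<Longrightarrow> open T \<Longrightarrow> f ` S \<subseteq> T \<Longrightarrow> smooth_on T g \<Longrightarrow> smooth_on S f
    \<Longrightarrow> smooth_on S (\<lambda>x. g (f x))"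
  by (simp add: smooth_on_def higher_differentiable_on_compose)

lemma smooth_on_linear_compose:
  assumes "open S" "bounded_linear L" "L ` S \<subseteq> T" "smooth_on T f"
  shows "smooth_on S (\<lambda>x. f (L x))"
proof -
  have "higher_differentiable_on S (\<lambda>x. f (L x)) n" if "higher_differentiable_on T f n" for n
    using that
  proof (induction n arbitrary: f)
    case 0
    then show ?case
      using assms(3) continuous_on_compose2[of T f S L] linear_continuous_on[OF assms(2)] by simp
  next
    case (Suc n)
    show ?case
    proof (rule higher_differentiable_on_SucI[OF assms(1), where f'="\<lambda>x v. frechet_derivative f (at (L x)) (L v)"])
      fix x assume "x \<in> S"
      then have "(f has_derivative frechet_derivative f (at (L x))) (at (L x))"
        using assms(3) higher_differentiable_on_Suc_has_derivative[OF Suc.prems] by auto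
      then show "((\<lambda>x. f (L x)) has_derivative (\<lambda>v. frechet_derivative f (at (L x)) (L v))) (at x)"
        using has_derivative_compose[OF bounded_linear_imp_has_derivative[OF assms(2)]] by blast
    next
      show "higher_differentiable_on S (\<lambda>x. frechet_derivative f (at (L x)) (L v)) n" for v
        using Suc.IH[of "\<lambda>y. frechet_derivative f (at y) (L v)"] Suc.prems by simp
    qed
  qed
  with assms(4) show ?thesis by (simp add: smooth_on_def)
qed

lemma smooth_on_imp_differentiable:
  "smooth_on S f \<Longrightarrow> x \<in> S \<Longrightarrow> f differentiable (at x)"
  unfolding smooth_on_def using higher_differentiable_on.simps(2)[of S f 0] by blast

lemma smooth_on_imp_continuous_on: "smooth_on S f \<Longrightarrow> continuous_on S f"
  unfolding smooth_on_def using higher_differentiable_on.simps(1)[of S f] by blast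

lemma smooth_on_frechet_derivative:
  "smooth_on S f \<Longrightarrow> smooth_on S (\<lambda>x. frechet_derivative f (at x) v)"
  unfolding smooth_on_def using higher_differentiable_on.simps(2)[of S f] by blast

lemma smooth_on_subset: "smooth_on S f \<Longrightarrow> T \<subseteq> S \<Longrightarrow> smooth_on T f"
  unfolding smooth_on_def by (blast intro: higher_differentiable_on_subset)

lemma smooth_on_real_deriv:
  fixes f :: "real \<Rightarrow> real"
  assumes "smooth_on S f" "open S"
  shows "\<And>x. x \<in> S \<Longrightarrow> (f has_real_derivative deriv f x) (at x)" "smooth_on S (deriv f)"
proof -
  have *: "(f has_real_derivative frechet_derivative f (at x) 1) (at x)" if x: "x \<in> S" for x
  proof -
    have d: "(f has_derivative frechet_derivative f (at x)) (at x)"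
      using smooth_on_imp_differentiable[OF assms(1) x] by (simp add: frechet_derivative_works[symmetric])
    have eq: "frechet_derivative f (at x) = (*) (frechet_derivative f (at x) 1)"
    proof
      show "frechet_derivative f (at x) r = frechet_derivative f (at x) 1 * r" for r
        using linear_scale[OF has_derivative_linear[OF d], of r 1] by (simp add: mult.commute)
    qed
    show ?thesis unfolding has_field_derivative_def eq[symmetric] by (rule d)
  qed
  then have eq: "deriv f x = frechet_derivative f (at x) 1" if "x \<in> S" for x
    using that DERIV_imp_deriv by blast
  show "(f has_real_derivative deriv f x) (at x)" if "x \<in> S" for x
    using *[OF that] eq[OF that] by simp
  show "smooth_on S (deriv f)"
    using smooth_on_frechet_derivative[OF assms(1), of 1] smooth_on_cong[OF assms(2), of "deriv f"] eq
    by auto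
qed

text \<open>Smoothness by bootstrapping: when the derivatives of a family of functions lie in the span of the
  family, induction on the order shows every member to be smooth. The families used are
  \<open>{cosh, sinh}\<close>, \<open>{cos, sin}\<close> and \<open>range flat_fun\<close>; in each of them two summands suffice.\<close>

lemma smooth_on_has_derivs_in_family:
  fixes \<F> :: "(real \<Rightarrow> real) set"
  assumes "f \<in> \<F>"
    and step: "\<And>f. f \<in> \<F> \<Longrightarrow> \<exists>a\<in>\<F>. \<exists>b\<in>\<F>. \<exists>c d. \<forall>x. (f has_real_derivative c * a x + d * b x) (at x)"
  shows "smooth_on UNIV f"
proof -
  have "higher_differentiable_on UNIV f n" if "f \<in> \<F>" for f n
    using that
  proof (induction n arbitrary: f)
    case 0
    then obtain a b c d where "\<And>x. (f has_real_derivative c * a x + d * b x) (at x)"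
      using step[of f] by blast
    then show ?case by (auto intro!: continuous_at_imp_continuous_on DERIV_isCont)
  next
    case (Suc n)
    then obtain a b c d where ab: "a \<in> \<F>" "b \<in> \<F>"
      and der: "\<forall>x. (f has_real_derivative c * a x + d * b x) (at x)" using step[of f] by blast
    show ?case
    proof (rule higher_differentiable_on_SucI)
      show "(f has_derivative (\<lambda>v. v *\<^sub>R (c *\<^sub>R a x + d *\<^sub>R b x))) (at x)" for x
        using der by (auto simp: has_field_derivative_def mult.commute[of _ "_ + _"])
      show "higher_differentiable_on UNIV (\<lambda>x. v *\<^sub>R (c *\<^sub>R a x + d *\<^sub>R b x)) n" for v
        using ab Suc.IH
        by (intro higher_differentiable_on_scaleR higher_differentiable_on_add
            higher_differentiable_on_const) auto
    qed auto
  qed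
  with assms(1) show ?thesis by (simp add: smooth_on_def)
qed

lemma smooth_on_cosh: "smooth_on UNIV (cosh :: real \<Rightarrow> real)"
  and smooth_on_sinh: "smooth_on UNIV (sinh :: real \<Rightarrow> real)"
proof -
  let ?F = "{cosh, sinh :: real \<Rightarrow> real}"
  have step: "\<exists>a\<in>?F. \<exists>b\<in>?F. \<exists>c d. \<forall>x. (f has_real_derivative c * a x + d * b x) (at x)"
    if "f \<in> ?F" for f
  proof -
    have "\<forall>x. (cosh has_real_derivative 1 * sinh x + 0 * cosh x) (at x)"
      "\<forall>x. (sinh has_real_derivative 1 * cosh x + 0 * cosh x) (at x)"
      by (auto intro!: derivative_eq_intros)
    with that show ?thesis by blast
  qed
  show "smooth_on UNIV (cosh :: real \<Rightarrow> real)" "smooth_on UNIV (sinh :: real \<Rightarrow> real)"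
    by (rule smooth_on_has_derivs_in_family[of _ ?F]; use step in blast)+
qed

lemma smooth_on_cos: "smooth_on UNIV (cos :: real \<Rightarrow> real)"
  and smooth_on_sin: "smooth_on UNIV (sin :: real \<Rightarrow> real)"
proof -
  let ?F = "{cos, sin :: real \<Rightarrow> real}"
  have step: "\<exists>a\<in>?F. \<exists>b\<in>?F. \<exists>c d. \<forall>x. (f has_real_derivative c * a x + d * b x) (at x)"
    if "f \<in> ?F" for f
  proof -
    have "\<forall>x. (cos has_real_derivative (-1) * sin x + 0 * cos x) (at x)"
      "\<forall>x. (sin has_real_derivative 1 * cos x + 0 * cos x) (at x)"
      by (auto intro!: derivative_eq_intros)
    with that show ?thesis by blast
  qed
  show "smooth_on UNIV (cos :: real \<Rightarrow> real)" "smooth_on UNIV (sin :: real \<Rightarrow> real)"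
    by (rule smooth_on_has_derivs_in_family[of _ ?F]; use step in blast)+
qed

section \<open>Bump functions\<close>

text \<open>The standard function \<open>exp (- 1 / t)\<close>, flat at the origin, together with its multiples by powers of
  \<open>1 / t\<close>, which are what its derivatives are made of.\<close>

definition flat_fun :: "nat \<Rightarrow> real \<Rightarrow> real" where
  "flat_fun j t = (if t > 0 then inverse t ^ j * exp (- inverse t) else 0)"

lemma flat_fun_tendsto_0: "(flat_fun j \<longlongrightarrow> 0) (at 0)"
proof -
  have "((\<lambda>x::real. x ^ j / exp x) \<longlongrightarrow> 0) at_top" by (rule tendsto_power_div_exp_0)
  then have "((\<lambda>t::real. inverse t ^ j / exp (inverse t)) \<longlongrightarrow> 0) (at_right 0)"
    using filterlim_compose filterlim_inverse_at_top_right by blast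
  then have r: "(flat_fun j \<longlongrightarrow> 0) (at_right 0)"
    by (rule Lim_transform_eventually)
       (auto simp: eventually_at_filter flat_fun_def exp_minus divide_inverse)
  have "(flat_fun j \<longlongrightarrow> 0) (at_left 0)"
    by (rule Lim_transform_eventually[OF tendsto_const])
       (auto simp: eventually_at_filter flat_fun_def)
  with r show ?thesis by (simp add: filterlim_at_split)
qed

lemma flat_fun_has_derivative:
  "(flat_fun j has_real_derivative (- real j) * flat_fun (Suc j) x + 1 * flat_fun (Suc (Suc j)) x) (at x)"
proof -
  consider "x > 0" | "x < 0" | "x = 0" by linarith
  then show ?thesis
  proof cases
    case 1
    let ?i = "inverse x"
    have "((\<lambda>t. inverse t ^ j * exp (- inverse t)) has_real_derivative
        (real j * ?i ^ (j - 1) * - (?i * ?i)) * exp (- ?i) + ?i ^ j * (exp (- ?i) * (?i * ?i))) (at x)"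
      using 1 by (auto intro!: derivative_eq_intros simp: power2_eq_square)
    also have "(real j * ?i ^ (j - 1) * - (?i * ?i)) * exp (- ?i) + ?i ^ j * (exp (- ?i) * (?i * ?i))
      = (- real j) * flat_fun (Suc j) x + 1 * flat_fun (Suc (Suc j)) x"
    proof (cases j)
      case (Suc n)
      have "- ((1 + c) * a * (i * i) * E) = (- 1 - c) * (i * (i * a) * E)" for a c i E :: real
        by algebra
      from this[of "real n" "?i ^ n" ?i "exp (- ?i)"] show ?thesis
        using 1 by (simp add: flat_fun_def Suc)
    qed (use 1 in \<open>simp add: flat_fun_def\<close>)
    finally have "((\<lambda>t. inverse t ^ j * exp (- inverse t)) has_real_derivative
        (- real j) * flat_fun (Suc j) x + 1 * flat_fun (Suc (Suc j)) x) (at x)" .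
    then show ?thesis
      by (rule has_field_derivative_transform_within_open[where S="{0<..}"])
         (use 1 in \<open>auto simp: flat_fun_def\<close>)
  next
    case 2
    then show ?thesis
      by (intro has_field_derivative_transform_within_open[OF DERIV_const[of 0], where S="{..<0}",
            THEN DERIV_cong]) (auto simp: flat_fun_def)
  next
    case 3
    have "(flat_fun j (0 + h) - flat_fun j 0) / h = flat_fun (Suc j) h" for h
      by (auto simp: flat_fun_def field_simps)
    then have "(flat_fun j has_real_derivative 0) (at 0)"
      unfolding DERIV_def using flat_fun_tendsto_0[of "Suc j"] by simp
    with 3 show ?thesis by (simp add: flat_fun_def)
  qed
qed

lemma smooth_on_flat_fun: "smooth_on UNIV (flat_fun j)"
  by (rule smooth_on_has_derivs_in_family[of _ "range flat_fun"])
     (use flat_fun_has_derivative in blast)+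

text \<open>The function \<open>x \<mapsto> exp (- 1 / (d\<^sup>2 - \<bar>x - x\<^sub>0\<bar>\<^sup>2))\<close>, cut off at the sphere. The squared distance is
  written as a polynomial in the coordinates to make its smoothness evident.\<close>

lemma exists_bump_function:
  fixes x\<^sub>0 :: "'a::euclidean_space"
  assumes "d > 0"
  obtains \<alpha> :: "'a \<Rightarrow> real" where "smooth_on UNIV \<alpha>" "\<And>x. \<alpha> x \<ge> 0" "\<alpha> x\<^sub>0 > 0"
    "\<And>x. x \<notin> cball x\<^sub>0 d \<Longrightarrow> \<alpha> x = 0"
proof
  define \<alpha> where "\<alpha> x = flat_fun 0 (d\<^sup>2 + (-1) * (\<Sum>i\<in>Basis. ((x - x\<^sub>0) \<bullet> i) * ((x - x\<^sub>0) \<bullet> i)))" for x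
  have sumsq: "(\<Sum>i\<in>Basis. ((x - x\<^sub>0) \<bullet> i) * ((x - x\<^sub>0) \<bullet> i)) = (dist x x\<^sub>0)\<^sup>2" for x
    unfolding dist_norm power2_norm_eq_inner by (rule euclidean_inner[symmetric])
  have lin: "smooth_on UNIV (\<lambda>x. (x - x\<^sub>0) \<bullet> i)" for i
  proof -
    have "smooth_on UNIV (\<lambda>x. x \<bullet> i + - (x\<^sub>0 \<bullet> i))"
      by (intro smooth_on_add smooth_on_linear smooth_on_const bounded_linear_inner_left) auto
    then show ?thesis by (simp add: inner_diff_left)
  qed
  have sum: "smooth_on UNIV (\<lambda>x. \<Sum>i\<in>B. ((x - x\<^sub>0) \<bullet> i) * ((x - x\<^sub>0) \<bullet> i))"
    if "finite B" for B :: "'a set"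
    using that
    by induction (auto intro!: smooth_on_const smooth_on_add smooth_on_mult lin)
  show "smooth_on UNIV \<alpha>" unfolding \<alpha>_def
    by (rule smooth_on_compose[OF open_UNIV open_UNIV subset_UNIV smooth_on_flat_fun];
        intro smooth_on_add smooth_on_const smooth_on_mult sum open_UNIV finite_Basis)
  show "\<alpha> x \<ge> 0" for x by (simp add: \<alpha>_def flat_fun_def)
  show "\<alpha> x\<^sub>0 > 0" using assms by (simp add: \<alpha>_def flat_fun_def)
  show "\<alpha> x = 0" if "x \<notin> cball x\<^sub>0 d" for x
  proof -
    have "d\<^sup>2 < (dist x x\<^sub>0)\<^sup>2"
      using that assms by (intro power_strict_mono) (auto simp: dist_commute)
    then show ?thesis by (simp add: \<alpha>_def flat_fun_def sumsq)
  qed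
qed

section \<open>Integrals of compactly supported functions\<close>

text \<open>By translation invariance the integral of \<open>x \<mapsto> V (x + t e)\<close> is constant for small \<open>t\<close>;
  differentiating under the integral sign at \<open>t = 0\<close> gives the integral of the directional derivative.
  This replaces the divergence theorem in the integrations by parts below.\<close>

lemma integral_derivative_compact_support_eq_0:
  fixes V V' :: "'a::euclidean_space \<Rightarrow> real"
  assumes deriv: "\<And>x. ((\<lambda>t. V (x + t *\<^sub>R e)) has_real_derivative V' x) (at 0)"
    and cont: "continuous_on UNIV V" "continuous_on UNIV V'"
    and supp: "compact B" "B \<subseteq> box a b" "\<And>x. x \<notin> B \<Longrightarrow> V x = 0"
  shows "integral (cbox a b) V' = 0"
proof -
  obtain r where r: "r > 0" "(\<Union>x\<in>B. ball x r) \<subseteq> box a b"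
    using compact_subset_open_imp_ball_epsilon_subset[OF supp(1) open_box supp(2)] by blast
  \<comment> \<open>The summand \<open>1\<close> admits \<open>e = 0\<close>.\<close>
  define d where "d = r / (1 + norm e)"
  have d: "d > 0" using r by (auto simp: d_def intro!: divide_pos_pos add_pos_nonneg)
  have small: "norm (t *\<^sub>R e) < r" if "\<bar>t\<bar> < d" for t
  proof -
    have "\<bar>t\<bar> * norm e \<le> \<bar>t\<bar> * (1 + norm e)" by (intro mult_left_mono) auto
    also have "\<dots> < d * (1 + norm e)" using that by (intro mult_strict_right_mono) (auto intro: add_pos_nonneg)
    also have "\<dots> = r" by (simp add: d_def add_pos_nonneg pos_add_strict less_imp_neq[THEN not_sym])
    finally show ?thesis by simp
  qed
  have shift: "integral (cbox a b) (\<lambda>x. V (x + t *\<^sub>R e)) = integral (cbox a b) V" if t: "\<bar>t\<bar> < d" for t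
  proof -
    let ?c = "t *\<^sub>R e"
    \<comment> \<open>The translated support stays inside the box, so both boxes carry the whole integral.\<close>
    have zero: "V (x + ?c) = 0" if "x \<notin> cbox a b \<or> x \<notin> cbox (a - ?c) (b - ?c)" for x
    proof (rule ccontr)
      assume "V (x + ?c) \<noteq> 0"
      then have *: "x + ?c \<in> B" using supp(3) by blast
      have "x \<in> ball (x + ?c) r" using small[OF t] by (simp add: dist_norm)
      with * r have "x \<in> box a b" by blast
      moreover have "x \<in> cbox (a - ?c) (b - ?c)"
        using * supp(2) by (force simp: mem_box inner_simps)
      ultimately show False using that box_subset_cbox by blast
    qed
    have "integral (cbox a b) (\<lambda>x. V (x + ?c)) = integral (cbox (a - ?c) (b - ?c)) (\<lambda>x. V (x + ?c))"
      by (subst (1 2) integral_restrict_UNIV[symmetric]) (intro arg_cong2[where f=integral] ext refl; use zero in auto)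
    then show ?thesis by (simp add: integral_shift_cbox)
  qed
  have "((\<lambda>t. integral (cbox a b) (\<lambda>x. V (x + t *\<^sub>R e))) has_real_derivative
      integral (cbox a b) (\<lambda>x. V' (x + 0 *\<^sub>R e))) (at 0 within UNIV)"
  proof (rule leibniz_rule_field_derivative[where fx="\<lambda>t x. V' (x + t *\<^sub>R e)"])
    fix t :: real and x :: 'a
    have "((\<lambda>s. V ((x + t *\<^sub>R e) + s *\<^sub>R e)) has_real_derivative V' (x + t *\<^sub>R e)) (at 0)"
      by (rule deriv)
    then have "((\<lambda>s. V (x + (s + t) *\<^sub>R e)) has_real_derivative V' (x + t *\<^sub>R e)) (at 0)"
      by (simp add: algebra_simps)
    then show "((\<lambda>t. V (x + t *\<^sub>R e)) has_real_derivative V' (x + t *\<^sub>R e)) (at t)"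
      using DERIV_shift[of "\<lambda>t. V (x + t *\<^sub>R e)" _ 0 t] by simp
    show "(\<lambda>x. V (x + t *\<^sub>R e)) integrable_on cbox a b"
      by (intro integrable_continuous continuous_on_compose2[OF cont(1)] continuous_intros) auto
  next
    show "continuous_on (UNIV \<times> cbox a b) (\<lambda>(t, x). V' (x + t *\<^sub>R e))"
      unfolding split_beta
      by (intro continuous_on_compose2[OF cont(2)] continuous_intros) auto
  qed auto
  then have "((\<lambda>t. integral (cbox a b) (\<lambda>x. V (x + t *\<^sub>R e))) has_real_derivative
      integral (cbox a b) V') (at 0)"
    by simp
  then have "((\<lambda>t. integral (cbox a b) V) has_real_derivative integral (cbox a b) V') (at 0)"
    by (rule has_field_derivative_transform_within_open[where S="ball 0 d"])
       (use d shift in \<open>auto simp: dist_norm\<close>)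
  then show ?thesis using DERIV_unique DERIV_const by blast
qed

text \<open>The fundamental lemma of the calculus of variations: where \<open>Z\<close> is nonzero it keeps its sign on a box,
  and a bump function supported there gives an integrand of that sign.\<close>

lemma integral_eq_0_test_functions_imp_eq_0:
  fixes Z :: "'a::euclidean_space \<Rightarrow> real"
  assumes "open D" "continuous_on D Z" "x\<^sub>0 \<in> D"
    and weak: "\<And>a b B \<alpha>. cbox a b \<subseteq> D \<Longrightarrow> compact B \<Longrightarrow> B \<subseteq> box a b \<Longrightarrow> smooth_on UNIV \<alpha>
      \<Longrightarrow> (\<And>x. x \<notin> B \<Longrightarrow> \<alpha> x = 0) \<Longrightarrow> integral (cbox a b) (\<lambda>x. Z x * \<alpha> x) = 0"
  shows "Z x\<^sub>0 = 0"
proof (rule ccontr)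
  assume nz: "Z x\<^sub>0 \<noteq> 0"
  define D' where "D' = D \<inter> (\<lambda>x. Z x\<^sub>0 * Z x) -` {0<..}"
  have "open D'" unfolding D'_def
    by (intro continuous_open_preimage continuous_intros assms)
  moreover have "x\<^sub>0 \<in> D'" using nz assms(3) by (auto simp: D'_def zero_less_mult_iff linorder_neq_iff)
  ultimately obtain a b where ab: "cbox a b \<subseteq> D'" "x\<^sub>0 \<in> box a b"
    using open_contains_cbox by metis
  obtain d where d: "d > 0" "cball x\<^sub>0 d \<subseteq> box a b"
    using ab(2) open_box open_contains_cball by metis
  obtain \<alpha> :: "'a \<Rightarrow> real" where al: "smooth_on UNIV \<alpha>" "\<And>x. \<alpha> x \<ge> 0" "\<alpha> x\<^sub>0 > 0"
    "\<And>x. x \<notin> cball x\<^sub>0 d \<Longrightarrow> \<alpha> x = 0"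
    using exists_bump_function[OF d(1)] by metis
  have sub: "cbox a b \<subseteq> D" using ab(1) by (auto simp: D'_def)
  have "integral (cbox a b) (\<lambda>x. Z x * \<alpha> x) = 0"
    using weak[OF sub compact_cball d(2) al(1,4)] by blast
  then have "integral (cbox a b) (\<lambda>x. Z x\<^sub>0 * (Z x * \<alpha> x)) = 0"
    by simp
  moreover have "continuous_on (cbox a b) (\<lambda>x. Z x\<^sub>0 * (Z x * \<alpha> x))"
    using sub assms(2) smooth_on_imp_continuous_on[OF al(1)]
    by (intro continuous_intros) (auto intro: continuous_on_subset)
  moreover have "Z x\<^sub>0 * (Z x * \<alpha> x) \<ge> 0" if "x \<in> cbox a b" for x
  proof -
    have "Z x\<^sub>0 * Z x \<ge> 0" using that ab(1) by (auto simp: D'_def intro: less_imp_le)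
    from mult_nonneg_nonneg[OF this al(2)[of x]] show ?thesis by (simp add: mult.assoc)
  qed
  ultimately have "\<forall>x\<in>cbox a b. Z x\<^sub>0 * (Z x * \<alpha> x) = 0"
    using ab(2) by (subst (asm) integral_cbox_eq_0_iff) auto
  moreover have "x\<^sub>0 \<in> cbox a b" using ab(2) box_subset_cbox by blast
  ultimately show False using nz al(3) by fastforce
qed

section \<open>Partial derivatives\<close>

text \<open>The relational counterpart of \<^const>\<open>partial_deriv\<close>, which also asserts that the partial derivative
  exists and therefore obeys the rules of calculus.\<close>

definition has_partial_deriv ::
    "'n::finite \<Rightarrow> (real^'n \<Rightarrow> 'b::real_normed_vector) \<Rightarrow> 'b \<Rightarrow> real^'n \<Rightarrow> bool" where
  "has_partial_deriv i f f' x \<longleftrightarrow> ((\<lambda>t. f (x + t *\<^sub>R axis i 1)) has_vector_derivative f') (at 0)"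

lemma has_partial_deriv_real:
  fixes f :: "real^'n::finite \<Rightarrow> real"
  shows "has_partial_deriv i f f' x \<longleftrightarrow> ((\<lambda>t. f (x + t *\<^sub>R axis i 1)) has_real_derivative f') (at 0)"
  by (simp add: has_partial_deriv_def has_real_derivative_iff_has_vector_derivative)

lemma partial_deriv_eq: "has_partial_deriv i f f' x \<Longrightarrow> partial_deriv i f x = f'"
  by (simp add: has_partial_deriv_def partial_deriv_def vector_derivative_at)

lemma has_partial_deriv_transform:
  assumes "has_partial_deriv i f f' x" "open D" "x \<in> D" "\<And>y. y \<in> D \<Longrightarrow> f y = g y"
  shows "has_partial_deriv i g f' x"
proof -
  let ?L = "(\<lambda>t. x + t *\<^sub>R axis i 1) -` D"
  have "open ?L" by (intro open_vimage assms(2) continuous_intros)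
  moreover have "0 \<in> ?L" using assms(3) by simp
  ultimately show ?thesis
    using has_vector_derivative_transform_within_open[where S="?L" and x=0 and f'=f'
        and f="\<lambda>t. f (x + t *\<^sub>R axis i 1)" and g="\<lambda>t. g (x + t *\<^sub>R axis i 1)"] assms(1,4)
    unfolding has_partial_deriv_def by simp
qed

lemma has_partial_deriv_const: "has_partial_deriv i (\<lambda>x. c) 0 x"
  by (simp add: has_partial_deriv_def)

lemma has_partial_deriv_coord:
  assumes "(f has_real_derivative f') (at (x $ i))"
  shows "has_partial_deriv i (\<lambda>x. f (x $ i)) f' x"
proof -
  have "((\<lambda>t. f (x $ i + t)) has_real_derivative f') (at 0)"
    using assms DERIV_shift[of f f' 0 "x $ i"] by (simp add: add.commute)
  then show ?thesis by (simp add: has_partial_deriv_real axis_def)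
qed

lemma has_partial_deriv_coord_other:
  "i \<noteq> j \<Longrightarrow> has_partial_deriv i (\<lambda>x. f (x $ j)) 0 x"
  by (simp add: has_partial_deriv_def axis_def)

lemma has_partial_deriv_frechet:
  assumes "f differentiable (at x)"
  shows "has_partial_deriv i f (frechet_derivative f (at x) (axis i 1)) x"
proof -
  have f: "(f has_derivative frechet_derivative f (at x)) (at (x + 0 *\<^sub>R axis i 1))"
    using assms by (simp add: frechet_derivative_works[symmetric])
  have "((\<lambda>t. x + t *\<^sub>R axis i 1) has_derivative (\<lambda>t. t *\<^sub>R axis i 1)) (at (0::real))"
    by (auto intro!: derivative_eq_intros)
  from has_derivative_compose[OF this f]
  show ?thesis
    using linear_scale[OF has_derivative_linear[OF f]]
    by (simp add: has_partial_deriv_def has_vector_derivative_def)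
qed

lemma has_partial_deriv_add:
  "has_partial_deriv i f f' x \<Longrightarrow> has_partial_deriv i g g' x
    \<Longrightarrow> has_partial_deriv i (\<lambda>x. f x + g x) (f' + g') x"
  unfolding has_partial_deriv_def by (rule has_vector_derivative_add)

lemma has_partial_deriv_scaleR_const:
  fixes f :: "real^'n::finite \<Rightarrow> real"
  shows "has_partial_deriv i f f' x \<Longrightarrow> has_partial_deriv i (\<lambda>x. f x *\<^sub>R v) (f' *\<^sub>R v) x"
  unfolding has_partial_deriv_real unfolding has_partial_deriv_def
  by (auto intro!: derivative_eq_intros)

lemma has_partial_deriv_mult:
  fixes f g :: "real^'n::finite \<Rightarrow> real"
  shows "has_partial_deriv i f f' x \<Longrightarrow> has_partial_deriv i g g' x
    \<Longrightarrow> has_partial_deriv i (\<lambda>x. f x * g x) (f' * g x + f x * g') x"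
  unfolding has_partial_deriv_real by (auto intro!: derivative_eq_intros)

lemma has_partial_deriv_chain:
  fixes f :: "real^'n::finite \<Rightarrow> real"
  assumes "(g has_real_derivative g') (at (f x))" "has_partial_deriv i f f' x"
  shows "has_partial_deriv i (\<lambda>x. g (f x)) (g' * f') x"
proof -
  have "(g has_real_derivative g') (at (f (x + 0 *\<^sub>R axis i 1)))" using assms(1) by simp
  from DERIV_chain2[where g="\<lambda>t. f (x + t *\<^sub>R axis i 1)", OF this] assms(2)
  show ?thesis by (simp add: has_partial_deriv_real)
qed

lemma partial_deriv_smooth:
  fixes \<alpha> :: "real^'n::finite \<Rightarrow> real"
  assumes "smooth_on UNIV \<alpha>"
  shows "has_partial_deriv i \<alpha> (partial_deriv i \<alpha> x) x" "smooth_on UNIV (partial_deriv i \<alpha>)"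
proof -
  have eq: "partial_deriv i \<alpha> x = frechet_derivative \<alpha> (at x) (axis i 1)"
    and *: "has_partial_deriv i \<alpha> (frechet_derivative \<alpha> (at x) (axis i 1)) x" for x
    using has_partial_deriv_frechet[OF smooth_on_imp_differentiable[OF assms UNIV_I]] partial_deriv_eq
    by blast+
  show "has_partial_deriv i \<alpha> (partial_deriv i \<alpha> x) x" using * eq by simp
  have "partial_deriv i \<alpha> = (\<lambda>x. frechet_derivative \<alpha> (at x) (axis i 1))" using eq by blast
  then show "smooth_on UNIV (partial_deriv i \<alpha>)" using smooth_on_frechet_derivative[OF assms] by simp
qed

lemma partial_deriv_eq_0_outside:
  assumes "closed B" "x \<notin> B" "\<And>x. x \<notin> B \<Longrightarrow> \<alpha> x = 0"
  shows "partial_deriv i \<alpha> x = 0"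
  by (rule partial_deriv_eq, rule has_partial_deriv_transform[OF has_partial_deriv_const, where D="-B"])
     (use assms in auto)

section \<open>Metrics of revolution\<close>

definition diag2 :: "real \<Rightarrow> real \<Rightarrow> real^2^2" where
  "diag2 a b = vector [vector [a, 0], vector [0, b]]"

lemma diag2_nth [simp]:
  "diag2 a b $ 1 $ 1 = a" "diag2 a b $ 1 $ 2 = 0" "diag2 a b $ 2 $ 1 = 0" "diag2 a b $ 2 $ 2 = b"
  by (simp_all add: diag2_def)

lemma matrix_inv_eqI:
  fixes A :: "'a::semiring_1^'n^'n"
  assumes "A ** B = mat 1" "B ** A = mat 1"
  shows "matrix_inv A = B"
proof -
  have "A ** matrix_inv A = mat 1 \<and> matrix_inv A ** A = mat 1"
    unfolding matrix_inv_def by (rule someI[of _ B]) (use assms in simp)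
  then have "matrix_inv A = (B ** A) ** matrix_inv A" by (simp add: assms)
  also have "\<dots> = B ** (A ** matrix_inv A)" by (simp add: matrix_mul_assoc)
  finally show ?thesis using \<open>A ** matrix_inv A = mat 1 \<and> _\<close> by simp
qed

lemma matrix_inv_diag2: "a \<noteq> 0 \<Longrightarrow> b \<noteq> 0 \<Longrightarrow> matrix_inv (diag2 a b) = diag2 (1 / a) (1 / b)"
  by (rule matrix_inv_eqI) (auto simp: vec_eq_iff forall_2 matrix_matrix_mult_def sum_2 mat_def)

locale revolution_metric =
  fixes D :: "(real^2) set" and g :: "real^2 \<Rightarrow> real^2^2" and U U1 F F1 :: "real \<Rightarrow> real"
  assumes open_D: "open D"
    and metric: "x \<in> D \<Longrightarrow> g x = diag2 (U (x $ 1)) (F (x $ 1))"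
    and deriv_U: "x \<in> D \<Longrightarrow> (U has_real_derivative U1 (x $ 1)) (at (x $ 1))"
    and deriv_F: "x \<in> D \<Longrightarrow> (F has_real_derivative F1 (x $ 1)) (at (x $ 1))"
    and U_pos: "x \<in> D \<Longrightarrow> U (x $ 1) > 0"
    and F_pos: "x \<in> D \<Longrightarrow> F (x $ 1) > 0"
begin

text \<open>The radial coefficient \<open>g\<^sup>i\<^sup>j \<Gamma>\<^sup>1\<^sub>i\<^sub>j\<close>: the Laplacian of a function \<open>f(r)\<close> is \<open>f'' / U - drift * f'\<close>.\<close>

definition drift :: "real \<Rightarrow> real" where
  "drift r = U1 r / (2 * (U r)\<^sup>2) - F1 r / (2 * U r * F r)"

lemma inv_metric: "x \<in> D \<Longrightarrow> matrix_inv (g x) = diag2 (1 / U (x $ 1)) (1 / F (x $ 1))"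
  using matrix_inv_diag2 U_pos F_pos metric by (simp add: less_imp_neq[THEN not_sym])

lemma partial_deriv_metric:
  assumes x: "x \<in> D"
  shows "partial_deriv 1 (\<lambda>y. g y $ 1 $ 1) x = U1 (x $ 1)"
    and "partial_deriv 1 (\<lambda>y. g y $ 2 $ 2) x = F1 (x $ 1)"
    and "partial_deriv 2 (\<lambda>y. g y $ 1 $ 1) x = 0"
    and "partial_deriv 2 (\<lambda>y. g y $ 2 $ 2) x = 0"
    and "partial_deriv i (\<lambda>y. g y $ 1 $ 2) x = 0"
    and "partial_deriv i (\<lambda>y. g y $ 2 $ 1) x = 0"
proof -
  note tr = partial_deriv_eq[OF has_partial_deriv_transform[OF _ open_D x]]
  show "partial_deriv 1 (\<lambda>y. g y $ 1 $ 1) x = U1 (x $ 1)"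
    by (rule tr[OF has_partial_deriv_coord[OF deriv_U[OF x]]]) (simp add: metric)
  show "partial_deriv 1 (\<lambda>y. g y $ 2 $ 2) x = F1 (x $ 1)"
    by (rule tr[OF has_partial_deriv_coord[OF deriv_F[OF x]]]) (simp add: metric)
  show "partial_deriv 2 (\<lambda>y. g y $ 1 $ 1) x = 0"
    by (rule tr[OF has_partial_deriv_coord_other[where j=1]]) (simp_all add: metric)
  show "partial_deriv 2 (\<lambda>y. g y $ 2 $ 2) x = 0"
    by (rule tr[OF has_partial_deriv_coord_other[where j=1]]) (simp_all add: metric)
  show "partial_deriv i (\<lambda>y. g y $ 1 $ 2) x = 0" "partial_deriv i (\<lambda>y. g y $ 2 $ 1) x = 0"
    by (rule tr[OF has_partial_deriv_const]; simp add: metric)+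
qed

lemma christoffel_eqs:
  assumes x: "x \<in> D"
  shows "christoffel g 1 1 1 x = U1 (x $ 1) / (2 * U (x $ 1))"
    and "christoffel g 1 2 2 x = - F1 (x $ 1) / (2 * U (x $ 1))"
    and "christoffel g 1 1 2 x = 0" and "christoffel g 1 2 1 x = 0"
    and "christoffel g 2 1 1 x = 0" and "christoffel g 2 2 2 x = 0"
    and "christoffel g 2 1 2 x = F1 (x $ 1) / (2 * F (x $ 1))"
    and "christoffel g 2 2 1 x = F1 (x $ 1) / (2 * F (x $ 1))"
  by (simp_all add: christoffel_def sum_2 inv_metric[OF x] partial_deriv_metric[OF x])

lemma laplacian_radial:
  assumes x: "x \<in> D"
    and f1: "\<And>y. y \<in> D \<Longrightarrow> (f has_real_derivative f1 (y $ 1)) (at (y $ 1))"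
    and f2: "(f1 has_real_derivative f2) (at (x $ 1))"
  shows "laplacian g (\<lambda>x. f (x $ 1)) x = f2 / U (x $ 1) - drift (x $ 1) * f1 (x $ 1)"
proof -
  have 1: "partial_deriv 1 (\<lambda>x. f (x $ 1)) y = f1 (y $ 1)" if "y \<in> D" for y :: "real^2"
    by (rule partial_deriv_eq[OF has_partial_deriv_coord[OF f1[OF that]]])
  have 2: "partial_deriv 2 (\<lambda>x. f (x $ 1)) y = 0" for y :: "real^2"
    by (rule partial_deriv_eq[OF has_partial_deriv_coord_other]) simp
  have 11: "partial_deriv 1 (partial_deriv 1 (\<lambda>x. f (x $ 1))) x = f2"
    by (rule partial_deriv_eq[OF has_partial_deriv_transform[OF has_partial_deriv_coord[OF f2] open_D x]])
       (simp add: 1)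
  have 22: "partial_deriv 2 (partial_deriv 2 (\<lambda>x. f (x $ 1))) x = 0"
    by (rule partial_deriv_eq[OF has_partial_deriv_transform[OF has_partial_deriv_const open_D x]])
       (simp add: 2)
  show ?thesis
    by (simp add: laplacian_def hessian_def sum_2 inv_metric[OF x] christoffel_eqs[OF x] 1[OF x] 2 11 22
        drift_def field_simps power2_eq_square)
qed

text \<open>Since \<open>g\<^sub>1\<^sub>1 / det g = 1 / F\<close>, the left-hand side is the curvature coefficient \<open>R\<^sup>1\<^sub>2\<^sub>1\<^sub>2\<close>.\<close>

lemma gauss_curvature_eq:
  assumes x: "x \<in> D" and F2: "(F1 has_real_derivative F2) (at (x $ 1))"
  shows "gauss_curvature g x * F (x $ 1)
    = - F2 / (2 * U (x $ 1)) + U1 (x $ 1) * F1 (x $ 1) / (4 * (U (x $ 1))\<^sup>2)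
      + (F1 (x $ 1))\<^sup>2 / (4 * U (x $ 1) * F (x $ 1))"
proof -
  let ?r = "x $ 1"
  have nz: "U ?r \<noteq> 0" "F ?r \<noteq> 0" using U_pos[OF x] F_pos[OF x] by auto
  have "((\<lambda>r. - F1 r / (2 * U r)) has_real_derivative
      - F2 / (2 * U ?r) + U1 ?r * F1 ?r / (2 * (U ?r)\<^sup>2)) (at ?r)"
    using nz deriv_U[OF x] F2
    by (auto intro!: derivative_eq_intros simp: field_simps power2_eq_square)
  then have 1: "partial_deriv 1 (christoffel g 1 2 2) x
      = - F2 / (2 * U ?r) + U1 ?r * F1 ?r / (2 * (U ?r)\<^sup>2)"
    by (intro partial_deriv_eq[OF has_partial_deriv_transform[OF has_partial_deriv_coord open_D x]])
       (simp_all add: christoffel_eqs)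
  have 2: "partial_deriv 2 (christoffel g 1 1 2) x = 0"
    by (rule partial_deriv_eq[OF has_partial_deriv_transform[OF has_partial_deriv_const open_D x]])
       (simp add: christoffel_eqs)
  have det: "det (g x) = U ?r * F ?r" by (simp add: metric[OF x] det_2)
  have "gauss_curvature g x = riemann g 1 2 1 2 x / F ?r"
    unfolding gauss_curvature_def det using nz by (simp add: sum_2 metric[OF x])
  also have "riemann g 1 2 1 2 x = - F2 / (2 * U ?r) + U1 ?r * F1 ?r / (2 * (U ?r)\<^sup>2)
      - U1 ?r * F1 ?r / (4 * (U ?r)\<^sup>2) + (F1 ?r)\<^sup>2 / (4 * U ?r * F ?r)"
    using nz by (simp add: riemann_def 1 2 sum_2 christoffel_eqs[OF x] field_simps power2_eq_square)
  finally have "gauss_curvature g x * F ?r = - F2 / (2 * U ?r) + U1 ?r * F1 ?r / (2 * (U ?r)\<^sup>2)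
      - U1 ?r * F1 ?r / (4 * (U ?r)\<^sup>2) + (F1 ?r)\<^sup>2 / (4 * U ?r * F ?r)"
    using nz by simp
  moreover have "t / (2 * (U ?r)\<^sup>2) - t / (4 * (U ?r)\<^sup>2) = t / (4 * (U ?r)\<^sup>2)" for t
    using nz by (simp add: field_simps)
  ultimately show ?thesis by (simp add: add.assoc[symmetric] diff_add_eq add_diff_eq[symmetric])
qed

lemma tension_eq:
  assumes x: "x \<in> D"
  shows "tension g \<phi> x = (1 / U (x $ 1)) *\<^sub>R cov_deriv \<phi> 1 (partial_deriv 1 \<phi>) x
    + (1 / F (x $ 1)) *\<^sub>R cov_deriv \<phi> 2 (partial_deriv 2 \<phi>) x
    - drift (x $ 1) *\<^sub>R partial_deriv 1 \<phi> x"
proof -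
  let ?r = "x $ 1"
  have nz: "U ?r \<noteq> 0" "F ?r \<noteq> 0" using U_pos[OF x] F_pos[OF x] by auto
  have "drift ?r = (1 / U ?r) * (U1 ?r / (2 * U ?r)) + (1 / F ?r) * (- F1 ?r / (2 * U ?r))"
    using nz by (simp add: drift_def field_simps power2_eq_square)
  then show ?thesis
    by (simp add: tension_def sum_2 inv_metric[OF x] christoffel_eqs[OF x] scaleR_right_diff_distrib
        scaleR_left_diff_distrib scaleR_add_left)
qed

end

section \<open>Maps in polar coordinates\<close>

text \<open>Vectors of \<open>\<L>\<^sup>3 \<times> \<real>\<close> by their four flat coordinates, so that vector identities become identities
  between real numbers.\<close>

definition ambient :: "real \<Rightarrow> real \<Rightarrow> real \<Rightarrow> real \<Rightarrow> (real^3) \<times> real" where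
  "ambient a b c d = (vector [a, b, c], d)"

lemma ambient_scaleR: "r *\<^sub>R ambient a b c d = ambient (r * a) (r * b) (r * c) (r * d)"
  by (simp add: ambient_def vec_eq_iff forall_3)

lemma ambient_add: "ambient a b c d + ambient a' b' c' d' = ambient (a + a') (b + b') (c + c') (d + d')"
  by (simp add: ambient_def vec_eq_iff forall_3)

lemma ambient_diff: "ambient a b c d - ambient a' b' c' d' = ambient (a - a') (b - b') (c - c') (d - d')"
  by (simp add: ambient_def vec_eq_iff forall_3)

lemma ip_ambient: "ip (ambient a b c d) (ambient a' b' c' d') = - (a * a') + b * b' + c * c' + d * d'"
  by (simp add: ambient_def ip_def mink_def)

lemma tangent_proj_ambient:
  "tangent_proj (ambient p q s e) (ambient a b c d)
    = ambient (a + (- (a * p) + b * q + c * s) * p) (b + (- (a * p) + b * q + c * s) * q)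
        (c + (- (a * p) + b * q + c * s) * s) d"
  by (simp add: ambient_def tangent_proj_def mink_def vec_eq_iff forall_3)

lemma ambient_eq_iff: "ambient a b c d = ambient a' b' c' d' \<longleftrightarrow> a = a' \<and> b = b' \<and> c = c' \<and> d = d'"
  by (auto simp: ambient_def vec_eq_iff forall_3)

lemma ambient_eq_sum:
  "ambient a b c d = a *\<^sub>R ambient 1 0 0 0 + (b *\<^sub>R ambient 0 1 0 0 + (c *\<^sub>R ambient 0 0 1 0 + d *\<^sub>R ambient 0 0 0 1))"
  by (simp add: ambient_scaleR ambient_add)

lemma has_partial_deriv_ambient:
  assumes "has_partial_deriv i a a' x" "has_partial_deriv i b b' x"
    "has_partial_deriv i c c' x" "has_partial_deriv i d d' x"
  shows "has_partial_deriv i (\<lambda>x. ambient (a x) (b x) (c x) (d x)) (ambient a' b' c' d') x"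
  by (subst (1 2) ambient_eq_sum)
     (intro has_partial_deriv_add has_partial_deriv_scaleR_const assms)

lemma smooth_on_ambient:
  assumes "open S" "smooth_on S a" "smooth_on S b" "smooth_on S c" "smooth_on S d"
  shows "smooth_on S (\<lambda>x. ambient (a x) (b x) (c x) (d x))"
  by (subst ambient_eq_sum) (intro smooth_on_add smooth_on_scaleR smooth_on_const assms)

text \<open>Maps into \<open>H\<^sup>2 \<times> \<real>\<close> whose angle in \<open>H\<^sup>2\<close> is the coordinate \<open>\<theta>\<close>, with signed distance \<open>K\<close> from the axis and
  height \<open>H\<close> depending on both coordinates. They comprise the rotation surfaces and those variations
  of them that are needed for the radial part of the biharmonic equation.\<close>

definition polar_map :: "(real^2 \<Rightarrow> real) \<Rightarrow> (real^2 \<Rightarrow> real) \<Rightarrow> real^2 \<Rightarrow> (real^3) \<times> real" where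
  "polar_map K H x = ambient (cosh (K x)) (sinh (K x) * cos (x $ 2)) (sinh (K x) * sin (x $ 2)) (H x)"

lemma rotation_surface_eq_polar_map:
  "rotation_surface k h = polar_map (\<lambda>x. k (x $ 1)) (\<lambda>x. h (x $ 1))"
  by (simp add: fun_eq_iff rotation_surface_def polar_map_def ambient_def)

lemma cosh_sq_real: "cosh (r::real) * cosh r = 1 + sinh r * sinh r"
  using cosh_square_eq[of r] by (simp add: power2_eq_square)

lemma cos_sq_real: "cos (r::real) * cos r = 1 - sin r * sin r"
  using sin_cos_squared_add[of r] by (simp add: power2_eq_square algebra_simps)

lemma polar_map_in_H2R: "polar_map K H x \<in> H2R"
proof -
  have "- (cosh (K x) * cosh (K x)) + sinh (K x) * cos (x $ 2) * (sinh (K x) * cos (x $ 2))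
      + sinh (K x) * sin (x $ 2) * (sinh (K x) * sin (x $ 2)) = -1"
    using cosh_sq_real[of "K x"] cos_sq_real[of "x $ 2"] by algebra
  then show ?thesis
    by (simp add: polar_map_def ambient_def H2R_def hyperboloid_def mink_def)
qed

lemma has_partial_deriv_polar_map:
  fixes K H :: "real^2 \<Rightarrow> real"
  assumes "has_partial_deriv i K K' x" "has_partial_deriv i H H' x"
    and "has_partial_deriv i (\<lambda>x. x $ 2) e x"
  shows "has_partial_deriv i (polar_map K H)
    (ambient (sinh (K x) * K')
       (cosh (K x) * K' * cos (x $ 2) - e * sinh (K x) * sin (x $ 2))
       (cosh (K x) * K' * sin (x $ 2) + e * sinh (K x) * cos (x $ 2)) H') x"
proof -
  have c: "has_partial_deriv i (\<lambda>x. cosh (K x)) (sinh (K x) * K') x"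
    and s: "has_partial_deriv i (\<lambda>x. sinh (K x)) (cosh (K x) * K') x"
    by (rule has_partial_deriv_chain[OF _ assms(1)]; auto intro!: derivative_eq_intros)+
  have co: "has_partial_deriv i (\<lambda>x. cos (x $ 2)) (- sin (x $ 2) * e) x"
    and si: "has_partial_deriv i (\<lambda>x. sin (x $ 2)) (cos (x $ 2) * e) x"
    by (rule has_partial_deriv_chain[OF _ assms(3)]; auto intro!: derivative_eq_intros)+
  show ?thesis
    unfolding polar_map_def
    using has_partial_deriv_ambient[OF c has_partial_deriv_mult[OF s co] has_partial_deriv_mult[OF s si] assms(2)]
    by (simp add: mult_ac)
qed

lemma has_partial_deriv_angle:
  "has_partial_deriv 1 (\<lambda>x::real^2. x $ 2) 0 x" "has_partial_deriv 2 (\<lambda>x::real^2. x $ 2) 1 x"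
  using has_partial_deriv_coord_other[of "1::2" 2 "\<lambda>x. x"] has_partial_deriv_coord[of "\<lambda>x. x" 1 x 2]
  by auto

lemma
  fixes f :: "real^'n::finite \<Rightarrow> real"
  assumes "has_partial_deriv i f f' x"
  shows has_partial_deriv_cosh: "has_partial_deriv i (\<lambda>x. cosh (f x)) (sinh (f x) * f') x"
    and has_partial_deriv_sinh: "has_partial_deriv i (\<lambda>x. sinh (f x)) (cosh (f x) * f') x"
    and has_partial_deriv_cos: "has_partial_deriv i (\<lambda>x. cos (f x)) (- sin (f x) * f') x"
    and has_partial_deriv_sin: "has_partial_deriv i (\<lambda>x. sin (f x)) (cos (f x) * f') x"
  by (rule has_partial_deriv_chain[OF _ assms]; auto intro!: derivative_eq_intros)+

text \<open>In the frame \<open>e = (S, C c, C s)\<close> (radial) and \<open>n = (0, -s, c)\<close> (angular) of \<open>H\<^sup>2\<close> the derivatives are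
  \<open>\<partial>\<^sub>1 = K\<^sub>1 e + H\<^sub>1\<close>, \<open>\<partial>\<^sub>2 = K\<^sub>2 e + S n\<close>, \<open>\<nabla>\<^sub>1\<partial>\<^sub>1 = K\<^sub>1\<^sub>1 e + H\<^sub>1\<^sub>1\<close> and
  \<open>\<nabla>\<^sub>2\<partial>\<^sub>2 = (K\<^sub>2\<^sub>2 - S C) e + 2 C K\<^sub>2 n\<close>. Only these second derivatives enter the tension field,
  because the metrics in question are diagonal.\<close>

lemma polar_map_derivs:
  fixes K H :: "real^2 \<Rightarrow> real"
  assumes D: "open D" "x \<in> D"
    and K1: "\<forall>y\<in>D. has_partial_deriv 1 K (K1 y) y"
    and K2: "\<forall>y\<in>D. has_partial_deriv 2 K (K2 y) y"
    and H1: "\<forall>y\<in>D. has_partial_deriv 1 H (H1 y) y"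
    and H2: "\<forall>y\<in>D. has_partial_deriv 2 H 0 y"
    and K11: "has_partial_deriv 1 K1 K11 x" and K22: "has_partial_deriv 2 K2 K22 x"
    and H11: "has_partial_deriv 1 H1 H11 x"
  defines "C \<equiv> cosh (K x)" and "S \<equiv> sinh (K x)" and "c \<equiv> cos (x $ 2)" and "s \<equiv> sin (x $ 2)"
  shows "partial_deriv 1 (polar_map K H) x = ambient (S * K1 x) (C * K1 x * c) (C * K1 x * s) (H1 x)"
    and "partial_deriv 2 (polar_map K H) x
      = ambient (S * K2 x) (C * K2 x * c - S * s) (C * K2 x * s + S * c) 0"
    and "cov_deriv (polar_map K H) 1 (partial_deriv 1 (polar_map K H)) x
      = ambient (S * K11) (C * K11 * c) (C * K11 * s) H11"
    and "cov_deriv (polar_map K H) 2 (partial_deriv 2 (polar_map K H)) x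
      = ambient (S * (K22 - S * C)) (C * (K22 - S * C) * c - 2 * C * K2 x * s)
          (C * (K22 - S * C) * s + 2 * C * K2 x * c) 0"
proof -
  note K1 = K1[rule_format] and K2 = K2[rule_format] and H1 = H1[rule_format] and H2 = H2[rule_format]
  note CS = cosh_sq_real[of "K x", folded C_def S_def] and cs = cos_sq_real[of "x $ 2", folded c_def s_def]
  have p1: "partial_deriv 1 (polar_map K H) y = ambient (sinh (K y) * K1 y)
      (cosh (K y) * K1 y * cos (y $ 2)) (cosh (K y) * K1 y * sin (y $ 2)) (H1 y)" if "y \<in> D" for y
    using partial_deriv_eq[OF has_partial_deriv_polar_map[OF K1[OF that] H1[OF that] has_partial_deriv_angle(1)]]
    by simp
  have p2: "partial_deriv 2 (polar_map K H) y = ambient (sinh (K y) * K2 y)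
      (cosh (K y) * K2 y * cos (y $ 2) + sinh (K y) * (- sin (y $ 2)))
      (cosh (K y) * K2 y * sin (y $ 2) + sinh (K y) * cos (y $ 2)) 0" if "y \<in> D" for y
    using partial_deriv_eq[OF has_partial_deriv_polar_map[OF K2[OF that] H2[OF that] has_partial_deriv_angle(2)]]
    by simp
  show "partial_deriv 1 (polar_map K H) x = ambient (S * K1 x) (C * K1 x * c) (C * K1 x * s) (H1 x)"
    "partial_deriv 2 (polar_map K H) x
      = ambient (S * K2 x) (C * K2 x * c - S * s) (C * K2 x * s + S * c) 0"
    using p1 p2 D(2) by (simp_all add: C_def S_def c_def s_def)
  note ders = has_partial_deriv_ambient has_partial_deriv_mult has_partial_deriv_add has_partial_deriv_cosh
    has_partial_deriv_sinh has_partial_deriv_cos has_partial_deriv_sin has_partial_deriv_angle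
  show "cov_deriv (polar_map K H) 1 (partial_deriv 1 (polar_map K H)) x
      = ambient (S * K11) (C * K11 * c) (C * K11 * s) H11"
  proof -
    have "has_partial_deriv 1 (partial_deriv 1 (polar_map K H)) (ambient
        (C * K1 x * K1 x + S * K11)
        ((S * K1 x * K1 x + C * K11) * c + C * K1 x * (- s * 0))
        ((S * K1 x * K1 x + C * K11) * s + C * K1 x * (c * 0)) H11) x"
      unfolding C_def S_def c_def s_def
      by (rule has_partial_deriv_transform[OF _ D p1[symmetric]])
         (intro ders K1 D K11 H11)
    then have *: "partial_deriv 1 (partial_deriv 1 (polar_map K H)) x
      = ambient (C * K1 x * K1 x + S * K11)
          ((S * K1 x * K1 x + C * K11) * c) ((S * K1 x * K1 x + C * K11) * s) H11"
      by (simp add: partial_deriv_eq)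
    have m: "- ((C * K1 x * K1 x + S * K11) * C) + (S * K1 x * K1 x + C * K11) * c * (S * c)
        + (S * K1 x * K1 x + C * K11) * s * (S * s) = - (K1 x * K1 x)"
      using CS cs by algebra
    show ?thesis
      unfolding cov_deriv_def polar_map_def[of K H x] *
        C_def[symmetric] S_def[symmetric] c_def[symmetric] s_def[symmetric] tangent_proj_ambient m
      by (simp add: ambient_eq_iff algebra_simps)
  qed
  show "cov_deriv (polar_map K H) 2 (partial_deriv 2 (polar_map K H)) x
      = ambient (S * (K22 - S * C)) (C * (K22 - S * C) * c - 2 * C * K2 x * s)
          (C * (K22 - S * C) * s + 2 * C * K2 x * c) 0"
  proof -
    have nsin: "has_partial_deriv 2 (\<lambda>y. - sin (y $ 2)) (- cos (x $ 2) * 1) x"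
      by (rule has_partial_deriv_chain[where g="\<lambda>t. - sin t", OF _ has_partial_deriv_angle(2)])
         (auto intro!: derivative_eq_intros)
    have "has_partial_deriv 2 (partial_deriv 2 (polar_map K H)) (ambient
        (C * K2 x * K2 x + S * K22)
        (((S * K2 x * K2 x + C * K22) * c + C * K2 x * (- s * 1)) + (C * K2 x * (- s) + S * (- c * 1)))
        (((S * K2 x * K2 x + C * K22) * s + C * K2 x * (c * 1)) + (C * K2 x * c + S * (- s * 1))) 0) x"
      unfolding C_def S_def c_def s_def
      by (rule has_partial_deriv_transform[OF _ D p2[symmetric]])
         (intro ders K2 D K22 nsin has_partial_deriv_const)
    then have *: "partial_deriv 2 (partial_deriv 2 (polar_map K H)) x
      = ambient (C * K2 x * K2 x + S * K22)
          ((S * K2 x * K2 x + C * K22 - S) * c - 2 * C * K2 x * s)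
          ((S * K2 x * K2 x + C * K22 - S) * s + 2 * C * K2 x * c) 0"
      by (simp add: partial_deriv_eq algebra_simps)
    have m: "- ((C * K2 x * K2 x + S * K22) * C)
        + ((S * K2 x * K2 x + C * K22 - S) * c - 2 * C * K2 x * s) * (S * c)
        + ((S * K2 x * K2 x + C * K22 - S) * s + 2 * C * K2 x * c) * (S * s) = - (K2 x * K2 x) - S * S"
      using CS cs by algebra
    show ?thesis
      unfolding cov_deriv_def polar_map_def[of K H x] *
        C_def[symmetric] S_def[symmetric] c_def[symmetric] s_def[symmetric] tangent_proj_ambient m
        ambient_eq_iff
    proof (intro conjI refl)
      show "C * K2 x * K2 x + S * K22 + (- (K2 x * K2 x) - S * S) * C = S * (K22 - S * C)"
        by algebra
      show "(S * K2 x * K2 x + C * K22 - S) * c - 2 * C * K2 x * s + (- (K2 x * K2 x) - S * S) * (S * c)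
          = C * (K22 - S * C) * c - 2 * C * K2 x * s"
        "(S * K2 x * K2 x + C * K22 - S) * s + 2 * C * K2 x * c + (- (K2 x * K2 x) - S * S) * (S * s)
          = C * (K22 - S * C) * s + 2 * C * K2 x * c"
        using CS by algebra+
    qed
  qed
qed

lemma rotation_surface_first_order:
  assumes "open D" "x \<in> D"
    and "\<And>y. y \<in> D \<Longrightarrow> (k has_real_derivative k1 (y $ 1)) (at (y $ 1))"
    and "\<And>y. y \<in> D \<Longrightarrow> (h has_real_derivative h1 (y $ 1)) (at (y $ 1))"
  shows "partial_deriv 1 (rotation_surface k h) x = ambient (sinh (k (x $ 1)) * k1 (x $ 1))
      (cosh (k (x $ 1)) * k1 (x $ 1) * cos (x $ 2)) (cosh (k (x $ 1)) * k1 (x $ 1) * sin (x $ 2)) (h1 (x $ 1))"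
    and "partial_deriv 2 (rotation_surface k h) x
      = ambient 0 (- sinh (k (x $ 1)) * sin (x $ 2)) (sinh (k (x $ 1)) * cos (x $ 2)) 0"
    and "induced_metric (rotation_surface k h) x
      = diag2 ((k1 (x $ 1))\<^sup>2 + (h1 (x $ 1))\<^sup>2) ((sinh (k (x $ 1)))\<^sup>2)"
proof -
  let ?r = "x $ 1"
  note CS = cosh_sq_real[of "k ?r"] and cs = cos_sq_real[of "x $ 2"]
  note K = has_partial_deriv_coord[OF assms(3)[OF assms(2)]] has_partial_deriv_coord[OF assms(4)[OF assms(2)]]
  have other: "has_partial_deriv 2 (\<lambda>x::real^2. f (x $ 1)) 0 x" for f :: "real \<Rightarrow> real"
    by (rule has_partial_deriv_coord_other) simp
  show p1: "partial_deriv 1 (rotation_surface k h) x = ambient (sinh (k ?r) * k1 ?r)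
      (cosh (k ?r) * k1 ?r * cos (x $ 2)) (cosh (k ?r) * k1 ?r * sin (x $ 2)) (h1 ?r)"
    unfolding rotation_surface_eq_polar_map
    using partial_deriv_eq[OF has_partial_deriv_polar_map[OF K has_partial_deriv_angle(1)]] by simp
  show p2: "partial_deriv 2 (rotation_surface k h) x
      = ambient 0 (- sinh (k ?r) * sin (x $ 2)) (sinh (k ?r) * cos (x $ 2)) 0"
    unfolding rotation_surface_eq_polar_map
    using partial_deriv_eq[OF has_partial_deriv_polar_map[OF other other has_partial_deriv_angle(2)]] by simp
  have 11: "ip (partial_deriv 1 (rotation_surface k h) x) (partial_deriv 1 (rotation_surface k h) x)
      = (k1 ?r)\<^sup>2 + (h1 ?r)\<^sup>2"
    unfolding p1 ip_ambient power2_eq_square using CS cs by algebra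
  have 22: "ip (partial_deriv 2 (rotation_surface k h) x) (partial_deriv 2 (rotation_surface k h) x)
      = (sinh (k ?r))\<^sup>2"
    unfolding p2 ip_ambient power2_eq_square using cs by algebra
  have 12: "ip (partial_deriv 1 (rotation_surface k h) x) (partial_deriv 2 (rotation_surface k h) x) = 0"
    "ip (partial_deriv 2 (rotation_surface k h) x) (partial_deriv 1 (rotation_surface k h) x) = 0"
    unfolding p1 p2 ip_ambient by (simp_all add: algebra_simps)
  show "induced_metric (rotation_surface k h) x = diag2 ((k1 ?r)\<^sup>2 + (h1 ?r)\<^sup>2) ((sinh (k ?r))\<^sup>2)"
    by (simp add: induced_metric_def vec_eq_iff forall_2 11 12 22)
qed

section \<open>Rotation surfaces\<close>

text \<open>The metric coefficients and tension components of the surface depend on \<open>r\<close> alone and are controlled on the set \<open>J\<close> of radii that occur in \<open>D\<close>;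
  \<open>J\<close> is open and possibly disconnected. A trailing \<open>1\<close> or \<open>2\<close> in a name marks a first or second derivative.\<close>

locale rotation_immersion =
  fixes k h :: "real \<Rightarrow> real" and D :: "(real^2) set"
  assumes D_open: "open D"
    and smooth_k: "smooth_on ((\<lambda>x. x $ 1) ` D) k"
    and smooth_h: "smooth_on ((\<lambda>x. x $ 1) ` D) h"
    and immersion: "immersion_on D (rotation_surface k h)"
begin

definition J :: "real set" where "J = (\<lambda>x. x $ 1) ` D"

definition "k1 = deriv k"
definition "k2 = deriv k1"
definition "h1 = deriv h"
definition "h2 = deriv h1"
definition "U r = (k1 r)\<^sup>2 + (h1 r)\<^sup>2"
definition "U1 r = 2 * (k1 r * k2 r + h1 r * h2 r)"
definition "F r = (sinh (k r))\<^sup>2"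
definition "F1 r = 2 * sinh (k r) * cosh (k r) * k1 r"

lemma open_J: "open J"
  unfolding J_def using D_open by (rule open_image_vec_nth)

lemma in_J: "x \<in> D \<Longrightarrow> x $ 1 \<in> J"
  by (simp add: J_def)

lemma derivs:
  assumes "r \<in> J"
  shows "(k has_real_derivative k1 r) (at r)" "(k1 has_real_derivative k2 r) (at r)"
    "(h has_real_derivative h1 r) (at r)" "(h1 has_real_derivative h2 r) (at r)"
    "(U has_real_derivative U1 r) (at r)" "(F has_real_derivative F1 r) (at r)"
proof -
  note k = smooth_on_real_deriv[OF smooth_k[folded J_def] open_J]
    and h = smooth_on_real_deriv[OF smooth_h[folded J_def] open_J]
  show 1: "(k has_real_derivative k1 r) (at r)" "(k1 has_real_derivative k2 r) (at r)"
    "(h has_real_derivative h1 r) (at r)" "(h1 has_real_derivative h2 r) (at r)"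
    using k(1) h(1) smooth_on_real_deriv(1)[OF k(2) open_J] smooth_on_real_deriv(1)[OF h(2) open_J] assms
    by (simp_all add: k1_def k2_def h1_def h2_def)
  have "U = (\<lambda>r. (k1 r)\<^sup>2 + (h1 r)\<^sup>2)" "F = (\<lambda>r. (sinh (k r))\<^sup>2)" by (auto simp: U_def F_def)
  then show "(U has_real_derivative U1 r) (at r)" "(F has_real_derivative F1 r) (at r)"
    by (auto intro!: derivative_eq_intros 1 simp: U1_def F1_def algebra_simps)
qed

lemma continuous_on_profile:
  "continuous_on J k" "continuous_on J k1" "continuous_on J k2" "continuous_on J h1" "continuous_on J h2"
proof -
  note k = smooth_on_real_deriv(2)[OF smooth_k[folded J_def] open_J]
    and h = smooth_on_real_deriv(2)[OF smooth_h[folded J_def] open_J]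
  show "continuous_on J k" using smooth_k[folded J_def] by (rule smooth_on_imp_continuous_on)
  show "continuous_on J k1" "continuous_on J k2" "continuous_on J h1" "continuous_on J h2"
    unfolding k1_def k2_def h1_def h2_def
    by (intro smooth_on_imp_continuous_on k h smooth_on_real_deriv(2)[OF _ open_J])+
qed

lemma surface_partial_derivs:
  assumes "x \<in> D"
  shows "partial_deriv 1 (rotation_surface k h) x = ambient (sinh (k (x $ 1)) * k1 (x $ 1))
      (cosh (k (x $ 1)) * k1 (x $ 1) * cos (x $ 2)) (cosh (k (x $ 1)) * k1 (x $ 1) * sin (x $ 2)) (h1 (x $ 1))"
    and "partial_deriv 2 (rotation_surface k h) x
      = ambient 0 (- sinh (k (x $ 1)) * sin (x $ 2)) (sinh (k (x $ 1)) * cos (x $ 2)) 0"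
    and "induced_metric (rotation_surface k h) x = diag2 (U (x $ 1)) (F (x $ 1))"
  using rotation_surface_first_order[OF D_open assms derivs(1)[OF in_J] derivs(3)[OF in_J]]
  unfolding U_def F_def by auto

text \<open>Injectivity of the differential means that neither \<open>\<partial>\<^sub>1\<close> nor \<open>\<partial>\<^sub>2\<close> vanishes, that is, \<open>(k', h') \<noteq> 0\<close>
  and \<open>sinh k \<noteq> 0\<close>.\<close>

lemma metric_pos:
  assumes "x \<in> D"
  shows "U (x $ 1) > 0" "F (x $ 1) > 0"
proof -
  let ?\<psi> = "rotation_surface k h"
  have diff: "?\<psi> differentiable (at x)" and inj: "inj (frechet_derivative ?\<psi> (at x))"
    using immersion assms smooth_on_imp_differentiable by (auto simp: immersion_on_def)
  have lin: "linear (frechet_derivative ?\<psi> (at x))"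
    using diff frechet_derivative_works has_derivative_linear by blast
  have nz: "partial_deriv i ?\<psi> x \<noteq> 0" for i
  proof -
    have "frechet_derivative ?\<psi> (at x) (axis i 1) \<noteq> 0"
      using linear_injective_0[OF lin] inj by (metis axis_eq_0_iff zero_neq_one)
    then show ?thesis using partial_deriv_eq[OF has_partial_deriv_frechet[OF diff]] by metis
  qed
  have zero: "ambient 0 0 0 0 = 0" by (simp add: ambient_def vec_eq_iff forall_3 zero_prod_def)
  have "k1 (x $ 1) \<noteq> 0 \<or> h1 (x $ 1) \<noteq> 0"
    using nz[of 1] zero unfolding surface_partial_derivs(1)[OF assms] by auto
  then show "U (x $ 1) > 0" unfolding U_def by (auto simp: add_pos_nonneg add_nonneg_pos)
  have "sinh (k (x $ 1)) \<noteq> 0"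
    using nz[of 2] zero unfolding surface_partial_derivs(2)[OF assms] by auto
  then show "F (x $ 1) > 0" by (simp add: F_def)
qed

lemma profile_pos: "r \<in> J \<Longrightarrow> U r > 0" "r \<in> J \<Longrightarrow> sinh (k r) \<noteq> 0"
  using metric_pos by (auto simp: J_def F_def)

sublocale revolution_metric D "induced_metric (rotation_surface k h)" U U1 F F1
  by unfold_locales (use D_open surface_partial_derivs(3) derivs(5,6) in_J metric_pos in auto)

text \<open>The tension field of the surface is \<open>T e + W \<partial>\<^sub>h\<close>, where \<open>e\<close> is the unit radial field of \<open>H\<^sup>2\<close> and
  \<open>\<partial>\<^sub>h\<close> the vertical unit field: \<open>T = \<Delta>k - coth k\<close> and \<open>W = \<Delta>h\<close>.\<close>

definition T :: "real \<Rightarrow> real" where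
  "T r = k2 r / U r - drift r * k1 r - cosh (k r) / sinh (k r)"

definition W :: "real \<Rightarrow> real" where
  "W r = h2 r / U r - drift r * h1 r"

lemma laplacian_k:
  "x \<in> D \<Longrightarrow> laplacian (induced_metric (rotation_surface k h)) (\<lambda>x. k (x $ 1)) x
    = k2 (x $ 1) / U (x $ 1) - drift (x $ 1) * k1 (x $ 1)"
  by (rule laplacian_radial) (use derivs in_J in auto)

lemma continuous_on_coefficients:
  "continuous_on J U" "continuous_on J F" "continuous_on J drift" "continuous_on J T" "continuous_on J W"
proof -
  note k = continuous_on_profile
  have nz: "\<forall>r\<in>J. U r \<noteq> 0" "\<forall>r\<in>J. F r \<noteq> 0" "\<forall>r\<in>J. sinh (k r) \<noteq> 0"
    using profile_pos by (auto simp: F_def less_imp_neq[THEN not_sym])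
  show U: "continuous_on J U" and F: "continuous_on J F"
    unfolding U_def[abs_def] F_def[abs_def] by (intro continuous_intros k)+
  have "continuous_on J U1" "continuous_on J F1"
    unfolding U1_def[abs_def] F1_def[abs_def] by (intro continuous_intros k)+
  with U F show d: "continuous_on J drift"
    unfolding drift_def[abs_def] using nz by (intro continuous_intros) auto
  show "continuous_on J T" "continuous_on J W"
    unfolding T_def[abs_def] W_def[abs_def] using nz by (auto intro!: continuous_intros k U d)
qed

end

section \<open>First variation of the bienergy\<close>

text \<open>Differentiation under the integral sign for the bienergy density \<open>(P\<^sup>2 + Q\<^sup>2 + W\<^sup>2) w\<close> of the varied
  surface. Its radial part \<open>P\<close> contributes the derivative, whereas the angular part \<open>Q\<close> is of first order
  in \<open>t\<close> and the vertical part \<open>W\<close> does not depend on \<open>t\<close>.\<close>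

lemma energy_derivative:
  fixes \<kappa> \<alpha> T0 M \<beta> \<iota> W w :: "'a::euclidean_space \<Rightarrow> real"
  assumes cont: "continuous_on (cbox a b) \<kappa>" "continuous_on (cbox a b) \<alpha>" "continuous_on (cbox a b) T0"
    "continuous_on (cbox a b) M" "continuous_on (cbox a b) \<beta>" "continuous_on (cbox a b) \<iota>"
    "continuous_on (cbox a b) W" "continuous_on (cbox a b) w"
  defines "P \<equiv> \<lambda>t x. T0 x + t * M x - sinh (\<kappa> x + t * \<alpha> x) * cosh (\<kappa> x + t * \<alpha> x) * \<iota> x"
    and "Q \<equiv> \<lambda>t x. 2 * cosh (\<kappa> x + t * \<alpha> x) * (t * \<beta> x) * \<iota> x"
  defines "f \<equiv> \<lambda>t x. (P t x * P t x + Q t x * Q t x + W x * W x) * w x"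
  shows "continuous_on (cbox a b) (f t)"
    and "((\<lambda>t. integral (cbox a b) (f t)) has_real_derivative integral (cbox a b) (\<lambda>x.
      2 * (P 0 x * (M x - (1 + 2 * (sinh (\<kappa> x) * sinh (\<kappa> x))) * \<alpha> x * \<iota> x) * w x))) (at 0)"
proof -
  have f_cont: "continuous_on (cbox a b) (f t)" for t
    unfolding f_def P_def Q_def by (intro continuous_intros cont)
  then show "continuous_on (cbox a b) (f t)" .
  define P' where "P' t x = M x - (cosh (\<kappa> x + t * \<alpha> x) * cosh (\<kappa> x + t * \<alpha> x)
      + sinh (\<kappa> x + t * \<alpha> x) * sinh (\<kappa> x + t * \<alpha> x)) * \<alpha> x * \<iota> x" for t x
  define Q' where "Q' t x = 2 * cosh (\<kappa> x + t * \<alpha> x) * \<beta> x * \<iota> x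
      + 2 * sinh (\<kappa> x + t * \<alpha> x) * \<alpha> x * (t * \<beta> x) * \<iota> x" for t x
  define f' where "f' t x = 2 * (P t x * P' t x + Q t x * Q' t x) * w x" for t x
  have P': "((\<lambda>t. P t x) has_real_derivative P' t x) (at t)" for t x
    unfolding P_def P'_def by (auto intro!: derivative_eq_intros simp: algebra_simps)
  have Q': "((\<lambda>t. Q t x) has_real_derivative Q' t x) (at t)" for t x
    unfolding Q_def Q'_def by (auto intro!: derivative_eq_intros simp: algebra_simps)
  have f': "((\<lambda>t. f t x) has_real_derivative f' t x) (at t)" for t x
    unfolding f_def f'_def
    by (auto intro!: derivative_eq_intros P' Q' simp: algebra_simps)
  have snd: "continuous_on (UNIV \<times> cbox a b) (\<lambda>p. g (snd p))" if "continuous_on (cbox a b) g"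
    for g :: "'a \<Rightarrow> real"
    by (rule continuous_on_compose2[OF that]) (auto intro: continuous_intros)
  have "continuous_on (UNIV \<times> cbox a b) (\<lambda>(t, x). f' t x)"
    unfolding split_beta f'_def P_def Q_def P'_def Q'_def
    by (intro continuous_intros snd cont)
  then have "((\<lambda>t. integral (cbox a b) (f t)) has_real_derivative integral (cbox a b) (f' 0)) (at 0 within UNIV)"
    using f' f_cont
    by (intro leibniz_rule_field_derivative[where fx=f']) (auto intro: integrable_continuous)
  moreover have "f' 0 = (\<lambda>x. 2 * (P 0 x * (M x - (1 + 2 * (sinh (\<kappa> x) * sinh (\<kappa> x))) * \<alpha> x * \<iota> x) * w x))"
    by (simp add: fun_eq_iff f'_def P'_def Q_def cosh_sq_real algebra_simps)
  ultimately show "((\<lambda>t. integral (cbox a b) (f t)) has_real_derivative integral (cbox a b) (\<lambda>x.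
      2 * (P 0 x * (M x - (1 + 2 * (sinh (\<kappa> x) * sinh (\<kappa> x))) * \<alpha> x * \<iota> x) * w x))) (at 0)"
    by simp
qed

context rotation_immersion
begin

text \<open>The area density \<open>sqrt (det g)\<close>.\<close>

definition w :: "real \<Rightarrow> real" where "w r = sqrt (U r * F r)"

lemma w_pos: "r \<in> J \<Longrightarrow> w r > 0" and w_sq: "r \<in> J \<Longrightarrow> w r * w r = U r * F r"
  using profile_pos[of r] by (auto simp: w_def F_def)

lemma continuous_on_radial:
  "continuous_on J f \<Longrightarrow> X \<subseteq> D \<Longrightarrow> continuous_on X (\<lambda>x. f (x $ 1))"
  by (rule continuous_on_compose2[where t=J]) (auto intro!: continuous_intros in_J)

text \<open>For the variation \<open>k + t\<alpha>\<close> of the profile the tension is \<open>P e + Q n + W \<partial>\<^sub>h\<close> in the orthonormal frame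
  along the varied map. The metric of the domain stays that of the original surface, hence the factor
  \<open>1 / F\<close> in the term \<open>sinh K cosh K / F\<close>, which becomes \<open>coth k\<close> at \<open>t = 0\<close>.\<close>

lemma tension_variation:
  fixes \<alpha> :: "real^2 \<Rightarrow> real" and t :: real
  assumes x: "x \<in> D" and \<alpha>: "smooth_on UNIV \<alpha>"
  defines "\<phi> \<equiv> polar_map (\<lambda>x. k (x $ 1) + t * \<alpha> x) (\<lambda>x. h (x $ 1))"
  defines "K \<equiv> k (x $ 1) + t * \<alpha> x"
  defines "M \<equiv> partial_deriv 1 (partial_deriv 1 \<alpha>) x / U (x $ 1) + partial_deriv 2 (partial_deriv 2 \<alpha>) x / F (x $ 1)
      - drift (x $ 1) * partial_deriv 1 \<alpha> x"
  defines "P \<equiv> (k2 (x $ 1) / U (x $ 1) - drift (x $ 1) * k1 (x $ 1)) + t * M - sinh K * cosh K * (1 / F (x $ 1))"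
    and "Q \<equiv> 2 * cosh K * (t * partial_deriv 2 \<alpha> x) * (1 / F (x $ 1))"
  shows "tension (induced_metric (rotation_surface k h)) \<phi> x
      = ambient (sinh K * P) (cosh K * P * cos (x $ 2) - Q * sin (x $ 2))
          (cosh K * P * sin (x $ 2) + Q * cos (x $ 2)) (W (x $ 1))"
    and "ip (tension (induced_metric (rotation_surface k h)) \<phi> x) (tension (induced_metric (rotation_surface k h)) \<phi> x)
      = P * P + Q * Q + W (x $ 1) * W (x $ 1)"
proof -
  let ?r = "x $ 1"
  have scale: "has_partial_deriv i (\<lambda>x. t * f x) (t * f') x"
    if "has_partial_deriv i f f' x" for i f f' and x :: "real^2"
    using has_partial_deriv_mult[OF has_partial_deriv_const[of i t] that] by simp
  note \<alpha>1 = partial_deriv_smooth(1)[OF \<alpha>]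
    and \<alpha>2 = partial_deriv_smooth(1)[OF partial_deriv_smooth(2)[OF \<alpha>]]
  have K1: "\<forall>y\<in>D. has_partial_deriv 1 (\<lambda>x. k (x $ 1) + t * \<alpha> x) (k1 (y $ 1) + t * partial_deriv 1 \<alpha> y) y"
    using has_partial_deriv_add[OF has_partial_deriv_coord[OF derivs(1)[OF in_J]] scale[OF \<alpha>1]] by blast
  have H1: "\<forall>y\<in>D. has_partial_deriv 1 (\<lambda>x. h (x $ 1)) (h1 (y $ 1)) y"
    using has_partial_deriv_coord[OF derivs(3)[OF in_J]] by blast
  have other: "has_partial_deriv 2 (\<lambda>x::real^2. f (x $ 1)) 0 y" for f :: "real \<Rightarrow> real" and y
    by (rule has_partial_deriv_coord_other) simp
  have K2: "\<forall>y\<in>D. has_partial_deriv 2 (\<lambda>x. k (x $ 1) + t * \<alpha> x) (0 + t * partial_deriv 2 \<alpha> y) y"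
    using has_partial_deriv_add[OF other scale[OF \<alpha>1]] by blast
  have H2: "\<forall>y\<in>D. has_partial_deriv 2 (\<lambda>x. h (x $ 1)) 0 y"
    using other by blast
  have K11: "has_partial_deriv 1 (\<lambda>y. k1 (y $ 1) + t * partial_deriv 1 \<alpha> y)
      (k2 ?r + t * partial_deriv 1 (partial_deriv 1 \<alpha>) x) x"
    and H11: "has_partial_deriv 1 (\<lambda>x. h1 (x $ 1)) (h2 ?r) x"
    by (rule has_partial_deriv_add[OF has_partial_deriv_coord[OF derivs(2)[OF in_J[OF x]]] scale[OF \<alpha>2]],
        rule has_partial_deriv_coord[OF derivs(4)[OF in_J[OF x]]])
  have K22: "has_partial_deriv 2 (\<lambda>y. 0 + t * partial_deriv 2 \<alpha> y) (0 + t * partial_deriv 2 (partial_deriv 2 \<alpha>) x) x"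
    by (intro has_partial_deriv_add has_partial_deriv_const scale \<alpha>2)
  note d = polar_map_derivs[OF D_open x K1 K2 H1 H2 K11 K22 H11, folded \<phi>_def K_def]
  have P: "P = (1 / U ?r) * (k2 ?r + t * partial_deriv 1 (partial_deriv 1 \<alpha>) x)
      + (1 / F ?r) * (0 + t * partial_deriv 2 (partial_deriv 2 \<alpha>) x - sinh K * cosh K)
      - drift ?r * (k1 ?r + t * partial_deriv 1 \<alpha> x)"
    by (simp add: P_def M_def algebra_simps add_divide_distrib diff_divide_distrib)
  have W: "W ?r = (1 / U ?r) * h2 ?r - drift ?r * h1 ?r" by (simp add: W_def)
  show eq: "tension (induced_metric (rotation_surface k h)) \<phi> x
      = ambient (sinh K * P) (cosh K * P * cos (x $ 2) - Q * sin (x $ 2))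
          (cosh K * P * sin (x $ 2) + Q * cos (x $ 2)) (W ?r)"
    unfolding tension_eq[OF x] d ambient_scaleR ambient_add ambient_diff P W Q_def
    by (simp add: ambient_eq_iff algebra_simps)
  show "ip (tension (induced_metric (rotation_surface k h)) \<phi> x) (tension (induced_metric (rotation_surface k h)) \<phi> x)
      = P * P + Q * Q + W (x $ 1) * W (x $ 1)"
    unfolding eq ip_ambient using cosh_sq_real[of K] cos_sq_real[of "x $ 2"] by algebra
qed

lemma smooth_on_variation:
  assumes \<alpha>: "smooth_on UNIV (\<alpha> :: real^2 \<Rightarrow> real)"
  shows "smooth_on ({- 1<..<1} \<times> D) (\<lambda>(t, x). polar_map (\<lambda>x. k (x $ 1) + t * \<alpha> x) (\<lambda>x. h (x $ 1)) x)"
proof -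
  let ?S = "{- 1<..<1::real} \<times> D"
  have S: "open ?S" by (intro open_Times D_open) auto
  have lin1: "bounded_linear (\<lambda>p::real \<times> (real^2). snd p $ i)" for i
    by (rule bounded_linear_compose[OF bounded_linear_vec_nth bounded_linear_snd])
  have rad: "smooth_on ?S (\<lambda>p. f (snd p $ 1))" if "smooth_on J f" for f :: "real \<Rightarrow> real"
    by (rule smooth_on_linear_compose[OF S lin1 _ that]) (auto intro: in_J)
  have \<alpha>': "smooth_on ?S (\<lambda>p. \<alpha> (snd p))"
    by (rule smooth_on_linear_compose[OF S bounded_linear_snd _ \<alpha>]) auto
  have K: "smooth_on ?S (\<lambda>p. k (snd p $ 1) + fst p * \<alpha> (snd p))"
    by (intro smooth_on_add smooth_on_mult S rad smooth_k[folded J_def] \<alpha>' smooth_on_linear bounded_linear_fst)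
  note comp = smooth_on_compose[OF S open_UNIV subset_UNIV]
  show ?thesis
    unfolding split_beta polar_map_def
    by (intro smooth_on_ambient smooth_on_mult S comp[OF smooth_on_cosh K] comp[OF smooth_on_sinh K]
        comp[OF smooth_on_cos smooth_on_linear[OF S lin1]] comp[OF smooth_on_sin smooth_on_linear[OF S lin1]]
        rad smooth_h[folded J_def])
qed

text \<open>The derivative at \<open>t = 0\<close> of the bienergy of the variation \<open>k + t\<alpha>\<close>. Here \<open>M\<close> is \<open>\<Delta>\<alpha>\<close>, and the factor
  \<open>1 + 2 sinh\<^sup>2 k = cosh (2 k)\<close> comes from differentiating \<open>sinh K cosh K\<close>.\<close>

lemma weak_radial_equation:
  fixes \<alpha> :: "real^2 \<Rightarrow> real"
  assumes bih: "biharmonic_on D (induced_metric (rotation_surface k h)) (rotation_surface k h)"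
    and sub: "cbox a b \<subseteq> D" and \<alpha>: "smooth_on UNIV \<alpha>" and supp: "\<And>x. x \<notin> cbox a b \<Longrightarrow> \<alpha> x = 0"
  defines "M \<equiv> \<lambda>x. partial_deriv 1 (partial_deriv 1 \<alpha>) x / U (x $ 1)
      + partial_deriv 2 (partial_deriv 2 \<alpha>) x / F (x $ 1) - drift (x $ 1) * partial_deriv 1 \<alpha> x"
  shows "integral (cbox a b) (\<lambda>x. T (x $ 1)
      * (M x - (1 + 2 * (sinh (k (x $ 1)))\<^sup>2) * \<alpha> x / F (x $ 1)) * w (x $ 1)) = 0"
proof -
  let ?g = "induced_metric (rotation_surface k h)"
  define \<Phi> where "\<Phi> t = polar_map (\<lambda>x. k (x $ 1) + t * \<alpha> x) (\<lambda>x. h (x $ 1))" for t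
  have \<Phi>0: "\<Phi> 0 = rotation_surface k h" by (simp add: \<Phi>_def rotation_surface_eq_polar_map)
  have "compact_variation D (rotation_surface k h) 1 (cbox a b) \<Phi>"
    unfolding compact_variation_def
  proof (intro conjI ballI)
    show "smooth_on ({- 1<..<1} \<times> D) (\<lambda>(t, x). \<Phi> t x)"
      unfolding \<Phi>_def by (rule smooth_on_variation[OF \<alpha>])
    show "\<Phi> t x \<in> H2R" for t x unfolding \<Phi>_def by (rule polar_map_in_H2R)
    show "\<Phi> t x = rotation_surface k h x" if "x \<in> D - cbox a b" for t x
      using supp that by (simp add: \<Phi>_def rotation_surface_eq_polar_map polar_map_def)
  qed (use sub \<Phi>0 in auto)
  with bih have crit: "((\<lambda>t. bienergy ?g (cbox a b) (\<Phi> t)) has_real_derivative 0) (at 0)"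
    unfolding biharmonic_on_def by blast
  define T0 where "T0 x = k2 (x $ 1) / U (x $ 1) - drift (x $ 1) * k1 (x $ 1)" for x :: "real^2"
  define f where "f t x = ((T0 x + t * M x - sinh (k (x $ 1) + t * \<alpha> x) * cosh (k (x $ 1) + t * \<alpha> x) * (1 / F (x $ 1)))
        * (T0 x + t * M x - sinh (k (x $ 1) + t * \<alpha> x) * cosh (k (x $ 1) + t * \<alpha> x) * (1 / F (x $ 1)))
      + 2 * cosh (k (x $ 1) + t * \<alpha> x) * (t * partial_deriv 2 \<alpha> x) * (1 / F (x $ 1))
        * (2 * cosh (k (x $ 1) + t * \<alpha> x) * (t * partial_deriv 2 \<alpha> x) * (1 / F (x $ 1)))
      + W (x $ 1) * W (x $ 1)) * w (x $ 1)" for t x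
  have nz: "U (x $ 1) \<noteq> 0" "F (x $ 1) \<noteq> 0" if "x \<in> cbox a b" for x
    using metric_pos[of x] sub that by auto
  note rad = continuous_on_radial[OF _ sub]
  note sm = smooth_on_imp_continuous_on[OF smooth_on_subset[OF _ subset_UNIV]]
  have c\<alpha>: "continuous_on (cbox a b) \<alpha>" "continuous_on (cbox a b) (partial_deriv i \<alpha>)"
    "continuous_on (cbox a b) (partial_deriv i (partial_deriv j \<alpha>))" for i j
    by (intro sm partial_deriv_smooth(2) \<alpha>)+
  have cU: "continuous_on (cbox a b) (\<lambda>x. U (x $ 1))" and cF: "continuous_on (cbox a b) (\<lambda>x. F (x $ 1))"
    and cd: "continuous_on (cbox a b) (\<lambda>x. drift (x $ 1))"
    by (intro rad continuous_on_coefficients)+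
  have cT0: "continuous_on (cbox a b) T0" and cM: "continuous_on (cbox a b) M"
    and cF': "continuous_on (cbox a b) (\<lambda>x. 1 / F (x $ 1))"
    unfolding T0_def[abs_def] M_def using nz
    by (auto intro!: continuous_intros cU cF cd c\<alpha> rad[OF continuous_on_profile(2)]
        rad[OF continuous_on_profile(3)])
  have cw: "continuous_on (cbox a b) (\<lambda>x. w (x $ 1))"
    unfolding w_def by (intro continuous_intros cU cF)
  note E = energy_derivative[OF rad[OF continuous_on_profile(1)] c\<alpha>(1) cT0 cM c\<alpha>(2)[of 2] cF'
      rad[OF continuous_on_coefficients(5)] cw, folded f_def]
  have "bienergy ?g (cbox a b) (\<Phi> t) = integral (cbox a b) (f t) / 2" for t
  proof -
    have "(\<integral>x\<in>cbox a b. ip (tension ?g (\<Phi> t) x) (tension ?g (\<Phi> t) x) * sqrt (det (?g x)) \<partial>lborel)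
      = (\<integral>x\<in>cbox a b. f t x \<partial>lborel)"
    proof (rule set_lebesgue_integral_cong)
      show "\<forall>x. x \<in> cbox a b \<longrightarrow>
        ip (tension ?g (\<Phi> t) x) (tension ?g (\<Phi> t) x) * sqrt (det (?g x)) = f t x"
      proof (intro allI impI)
        fix x assume "x \<in> cbox a b"
        then have x: "x \<in> D" using sub by auto
        have "det (?g x) = U (x $ 1) * F (x $ 1)" by (simp add: metric[OF x] det_2)
        then show "ip (tension ?g (\<Phi> t) x) (tension ?g (\<Phi> t) x) * sqrt (det (?g x)) = f t x"
          unfolding f_def \<Phi>_def T0_def M_def w_def using tension_variation(2)[OF x \<alpha>] by simp
      qed
    qed simp
    also have "set_integrable lborel (cbox a b) (f t)"
      unfolding set_integrable_def by (rule borel_integrable_compact[OF compact_cbox E(1)])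
    note set_borel_integral_eq_integral(2)[OF this]
    finally show ?thesis by (simp add: bienergy_def)
  qed
  with crit have "((\<lambda>t. integral (cbox a b) (f t) / 2) has_real_derivative 0) (at 0)" by simp
  from DERIV_unique[OF this DERIV_cdivide[OF E(2), of 2]]
  have "integral (cbox a b) (\<lambda>x. 2 * ((T0 x + 0 * M x
      - sinh (k (x $ 1) + 0 * \<alpha> x) * cosh (k (x $ 1) + 0 * \<alpha> x) * (1 / F (x $ 1)))
      * (M x - (1 + 2 * (sinh (k (x $ 1)) * sinh (k (x $ 1)))) * \<alpha> x * (1 / F (x $ 1))) * w (x $ 1))) = 0"
    by simp
  also have "integral (cbox a b) (\<lambda>x. 2 * ((T0 x + 0 * M x
      - sinh (k (x $ 1) + 0 * \<alpha> x) * cosh (k (x $ 1) + 0 * \<alpha> x) * (1 / F (x $ 1)))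
      * (M x - (1 + 2 * (sinh (k (x $ 1)) * sinh (k (x $ 1)))) * \<alpha> x * (1 / F (x $ 1))) * w (x $ 1)))
    = integral (cbox a b) (\<lambda>x. 2 * (T (x $ 1)
      * (M x - (1 + 2 * (sinh (k (x $ 1)))\<^sup>2) * \<alpha> x / F (x $ 1)) * w (x $ 1)))"
  proof (rule integral_cong)
    fix x assume "x \<in> cbox a b"
    then have "sinh (k (x $ 1)) \<noteq> 0" using nz(2) by (auto simp: F_def)
    then have "T (x $ 1) = T0 x - sinh (k (x $ 1)) * cosh (k (x $ 1)) * (1 / F (x $ 1))"
      by (simp add: T_def T0_def F_def power2_eq_square)
    then show "2 * ((T0 x + 0 * M x
      - sinh (k (x $ 1) + 0 * \<alpha> x) * cosh (k (x $ 1) + 0 * \<alpha> x) * (1 / F (x $ 1)))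
      * (M x - (1 + 2 * (sinh (k (x $ 1)) * sinh (k (x $ 1)))) * \<alpha> x * (1 / F (x $ 1))) * w (x $ 1))
      = 2 * (T (x $ 1) * (M x - (1 + 2 * (sinh (k (x $ 1)))\<^sup>2) * \<alpha> x / F (x $ 1)) * w (x $ 1))"
      by (simp add: power2_eq_square)
  qed
  finally show ?thesis by simp
qed

end

section \<open>The radial biharmonic equation\<close>

context rotation_immersion
begin

text \<open>This identity puts the Laplacian into divergence form: with \<open>p = w / U\<close> it gives
  \<open>w \<Delta>\<alpha> = \<partial>\<^sub>1(p \<partial>\<^sub>1\<alpha>) + \<partial>\<^sub>2(w / F \<partial>\<^sub>2\<alpha>)\<close>.\<close>

lemma area_density_deriv:
  assumes "r \<in> J"
  shows "((\<lambda>r. w r / U r) has_real_derivative - (w r * drift r)) (at r)"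
proof -
  note pos = profile_pos[OF assms] and w = w_pos[OF assms] w_sq[OF assms]
  have F: "F r > 0" using pos(2) by (simp add: F_def)
  have "((\<lambda>r. U r * F r) has_real_derivative U1 r * F r + F1 r * U r) (at r)"
    by (rule DERIV_mult[OF derivs(5,6)[OF assms]])
  moreover have "0 < U r * F r" using pos F by simp
  ultimately have "((\<lambda>r. sqrt (U r * F r)) has_real_derivative
      (inverse (sqrt (U r * F r)) / 2) * (U1 r * F r + F1 r * U r)) (at r)"
    by (intro DERIV_chain2[where g="\<lambda>r. U r * F r", OF DERIV_real_sqrt])
  then have "(w has_real_derivative (inverse (w r) / 2) * (U1 r * F r + F1 r * U r)) (at r)"
    by (simp add: w_def[abs_def])
  also have "(inverse (w r) / 2) * (U1 r * F r + F1 r * U r) = w r * (U1 r * F r + F1 r * U r) / (2 * (w r * w r))"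
    using w(1) by (simp add: field_simps)
  finally have "(w has_real_derivative w r * (U1 r * F r + F1 r * U r) / (2 * (U r * F r))) (at r)"
    unfolding w(2) .
  from DERIV_divide[OF this derivs(5)[OF assms]]
  show ?thesis
    using pos F by (rule_tac DERIV_cong) (auto simp: drift_def field_simps power2_eq_square)
qed

text \<open>The Laplacian in the weak equation is moved from \<open>\<alpha>\<close> to \<open>T\<close>. With \<open>p = w / U\<close>, the integrand of the weak
  equation plus \<open>\<alpha>\<close> times the expression \<open>Z\<close> that has to vanish is the sum of the partial derivatives of
  \<open>V = p (T \<partial>\<^sub>1\<alpha> - T' \<alpha>)\<close> and \<open>Y = T w / F \<partial>\<^sub>2\<alpha>\<close>, both supported in \<open>B\<close>.\<close>

lemma biharmonic_radial_equation:
  assumes bih: "biharmonic_on D (induced_metric (rotation_surface k h)) (rotation_surface k h)"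
    and T1: "\<And>r. r \<in> J \<Longrightarrow> (T has_real_derivative T1 r) (at r)"
    and T2: "\<And>r. r \<in> J \<Longrightarrow> (T1 has_real_derivative T2 r) (at r)"
    and cT2: "continuous_on J T2"
    and "r \<in> J"
  shows "T2 r / U r - drift r * T1 r = (1 + 2 * (sinh (k r))\<^sup>2) / F r * T r"
proof -
  obtain x\<^sub>0 where x0: "x\<^sub>0 \<in> D" "r = x\<^sub>0 $ 1" using \<open>r \<in> J\<close> by (auto simp: J_def)
  define p where "p r = w r / U r" for r
  define Z where "Z x = w (x $ 1) * ((1 + 2 * (sinh (k (x $ 1)))\<^sup>2) / F (x $ 1) * T (x $ 1)
      - (T2 (x $ 1) / U (x $ 1) - drift (x $ 1) * T1 (x $ 1)))" for x :: "real^2"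
  have cT1: "continuous_on J T1"
    by (intro continuous_at_imp_continuous_on ballI DERIV_isCont[OF T2])
  note co = continuous_on_profile continuous_on_coefficients cT1 cT2
  have nzJ: "\<forall>r\<in>J. U r \<noteq> 0" "\<forall>r\<in>J. F r \<noteq> 0"
    using profile_pos by (auto simp: F_def less_imp_neq[THEN not_sym])
  have cw: "continuous_on J w" unfolding w_def[abs_def] by (intro continuous_intros co)
  have cp: "continuous_on J p" "continuous_on J (\<lambda>r. w r / F r)"
    unfolding p_def[abs_def] using nzJ by (intro continuous_intros co cw; simp)+
  have "continuous_on J (\<lambda>r. w r * ((1 + 2 * (sinh (k r))\<^sup>2) / F r * T r - (T2 r / U r - drift r * T1 r)))"
    using nzJ by (intro continuous_intros co cw) auto
  then have cZ: "continuous_on D Z" unfolding Z_def[abs_def] by (rule continuous_on_radial) simp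
  have "Z x\<^sub>0 = 0"
  proof (rule integral_eq_0_test_functions_imp_eq_0[OF D_open cZ x0(1)])
    fix a b :: "real^2" and B and \<alpha> :: "real^2 \<Rightarrow> real"
    assume ab: "cbox a b \<subseteq> D" and B: "compact B" "B \<subseteq> box a b" and \<alpha>: "smooth_on UNIV \<alpha>"
      and supp: "\<And>x. x \<notin> B \<Longrightarrow> \<alpha> x = 0"
    have BD: "B \<subseteq> cbox a b" "B \<subseteq> D" using B ab box_subset_cbox by blast+
    have clB: "closed B" using B(1) by (rule compact_imp_closed)
    define a1 where "a1 = partial_deriv 1 \<alpha>"
    define a2 where "a2 = partial_deriv 2 \<alpha>"
    define a11 where "a11 = partial_deriv 1 a1"
    define a22 where "a22 = partial_deriv 2 a2"
    have sm: "smooth_on UNIV a1" "smooth_on UNIV a2" "smooth_on UNIV a11" "smooth_on UNIV a22"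
      unfolding a1_def a2_def a11_def a22_def by (intro partial_deriv_smooth(2) \<alpha>)+
    have d: "has_partial_deriv 1 \<alpha> (a1 x) x" "has_partial_deriv 2 \<alpha> (a2 x) x"
      "has_partial_deriv 1 a1 (a11 x) x" "has_partial_deriv 2 a2 (a22 x) x" for x
      using partial_deriv_smooth(1)[OF \<alpha>] partial_deriv_smooth(1)[OF sm(1)] partial_deriv_smooth(1)[OF sm(2)]
      by (auto simp: a1_def a2_def a11_def a22_def)
    have z1: "a1 x = 0" "a2 x = 0" if "x \<notin> B" for x
      unfolding a1_def a2_def using partial_deriv_eq_0_outside[OF clB that] supp by auto
    have z2: "a11 x = 0" "a22 x = 0" if "x \<notin> B" for x
      unfolding a11_def a22_def using partial_deriv_eq_0_outside[OF clB that] z1 by auto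
    note zero = supp z1 z2
    note s = smooth_on_imp_continuous_on[OF smooth_on_subset[OF _ subset_UNIV]]
    note sc = s[OF \<alpha>] s[OF sm(1)] s[OF sm(2)] s[OF sm(3)] s[OF sm(4)]
    \<comment> \<open>The coefficients are arbitrary outside \<open>D\<close>, but there they are multiplied by zero.\<close>
    have global: "continuous_on UNIV V" if "continuous_on D V" "\<And>x. x \<notin> B \<Longrightarrow> V x = 0"
      for V :: "real^2 \<Rightarrow> real"
    proof -
      have "continuous_on (-B) V"
        using continuous_on_cong[of "-B" "-B" V "\<lambda>_. 0"] that(2) by simp
      then have "continuous_on (D \<union> -B) V"
        using that(1) by (rule continuous_on_open_Un[OF D_open open_Compl[OF clB], rotated])
      moreover have "D \<union> -B = UNIV" using BD by blast
      ultimately show ?thesis by simp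
    qed
    have div: "integral (cbox a b) V' = 0"
      if "\<And>x. x \<in> D \<Longrightarrow> has_partial_deriv i V (V' x) x" "continuous_on D V" "continuous_on D V'"
        "\<And>x. x \<notin> B \<Longrightarrow> V x = 0" "\<And>x. x \<notin> B \<Longrightarrow> V' x = 0" for i and V V' :: "real^2 \<Rightarrow> real"
    proof (rule integral_derivative_compact_support_eq_0[where V=V and e="axis i 1" and B=B])
      show "((\<lambda>t. V (x + t *\<^sub>R axis i 1)) has_real_derivative V' x) (at 0)" for x
      proof (cases "x \<in> D")
        case False
        then have x: "x \<notin> B" using BD by blast
        have "has_partial_deriv i V 0 x"
          by (rule has_partial_deriv_transform[OF has_partial_deriv_const open_Compl[OF clB]])
             (use x that(4) in auto)
        then show ?thesis using that(5)[OF x] by (simp add: has_partial_deriv_real)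
      qed (use that(1) has_partial_deriv_real in blast)
    qed (use that B global in auto)
    define V where "V x = T (x $ 1) * p (x $ 1) * a1 x + (- 1) * (p (x $ 1) * T1 (x $ 1)) * \<alpha> x" for x
    define V' where "V' x = ((T1 (x $ 1) * p (x $ 1) + T (x $ 1) * - (w (x $ 1) * drift (x $ 1))) * a1 x
        + T (x $ 1) * p (x $ 1) * a11 x)
      + ((- 1) * (- (w (x $ 1) * drift (x $ 1)) * T1 (x $ 1) + p (x $ 1) * T2 (x $ 1)) * \<alpha> x
        + (- 1) * (p (x $ 1) * T1 (x $ 1)) * a1 x)" for x
    define Y where "Y x = T (x $ 1) * (w (x $ 1) / F (x $ 1)) * a2 x" for x
    define Y' where "Y' x = T (x $ 1) * (w (x $ 1) / F (x $ 1)) * a22 x" for x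
    define Q where "Q x = T (x $ 1) * ((a11 x / U (x $ 1) + a22 x / F (x $ 1) - drift (x $ 1) * a1 x)
      - (1 + 2 * (sinh (k (x $ 1)))\<^sup>2) * \<alpha> x / F (x $ 1)) * w (x $ 1)" for x
    note oD = continuous_on_radial[OF _ order_refl]
    have cV: "continuous_on D V" "continuous_on D V'" "continuous_on D Y" "continuous_on D Y'"
      unfolding V_def[abs_def] V'_def[abs_def] Y_def[abs_def] Y'_def[abs_def]
      by (intro continuous_intros sc oD[OF cp(1)] oD[OF cp(2)] oD[OF cw] oD[OF cT1] oD[OF cT2]
          oD[OF continuous_on_coefficients(3)] oD[OF continuous_on_coefficients(4)])+
    have iV: "integral (cbox a b) V' = 0"
    proof (rule div[where V=V and i=1])
      fix x assume "x \<in> D"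
      have r: "x $ 1 \<in> J" using \<open>x \<in> D\<close> by (rule in_J)
      have 1: "has_partial_deriv 1 (\<lambda>x. T (x $ 1) * p (x $ 1))
          (T1 (x $ 1) * p (x $ 1) + T (x $ 1) * - (w (x $ 1) * drift (x $ 1))) x"
        unfolding p_def
        by (rule has_partial_deriv_mult[OF has_partial_deriv_coord[OF T1[OF r]]
              has_partial_deriv_coord[OF area_density_deriv[OF r]]])
      have "((\<lambda>r. (- 1) * (p r * T1 r)) has_real_derivative
          (- 1) * (- (w (x $ 1) * drift (x $ 1)) * T1 (x $ 1) + p (x $ 1) * T2 (x $ 1))) (at (x $ 1))"
        using area_density_deriv[OF r, folded p_def] T2[OF r] by (auto intro!: derivative_eq_intros)
      from has_partial_deriv_coord[OF this]
      have 2: "has_partial_deriv 1 (\<lambda>x. (- 1) * (p (x $ 1) * T1 (x $ 1)))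
          ((- 1) * (- (w (x $ 1) * drift (x $ 1)) * T1 (x $ 1) + p (x $ 1) * T2 (x $ 1))) x" .
      show "has_partial_deriv 1 V (V' x) x"
        unfolding V_def[abs_def] V'_def
        by (rule has_partial_deriv_add[OF has_partial_deriv_mult[OF 1 d(3)] has_partial_deriv_mult[OF 2 d(1)]])
    qed (use cV zero in \<open>auto simp: V_def V'_def\<close>)
    have iY: "integral (cbox a b) Y' = 0"
    proof (rule div[where V=Y and i=2])
      fix x
      have "has_partial_deriv 2 (\<lambda>x::real^2. T (x $ 1) * (w (x $ 1) / F (x $ 1))) 0 x"
        by (rule has_partial_deriv_coord_other[where f="\<lambda>r. T r * (w r / F r)"]) simp
      from has_partial_deriv_mult[OF this d(4)]
      show "has_partial_deriv 2 Y (Y' x) x" unfolding Y_def[abs_def] Y'_def by simp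
    qed (use cV zero in \<open>auto simp: Y_def Y'_def\<close>)
    have iQ: "integral (cbox a b) Q = 0"
      unfolding Q_def a11_def a22_def a1_def a2_def
      by (rule weak_radial_equation[OF bih ab \<alpha>]) (use supp BD in auto)
    have cQ: "continuous_on D Q"
      unfolding Q_def[abs_def] using nzJ
      by (auto intro!: continuous_intros sc oD[OF cw] oD[OF continuous_on_coefficients(1)]
          oD[OF continuous_on_coefficients(2)] oD[OF continuous_on_profile(1)]
          oD[OF continuous_on_coefficients(3)] oD[OF continuous_on_coefficients(4)] in_J)
    have int: "V integrable_on cbox a b" if "continuous_on D V" for V :: "real^2 \<Rightarrow> real"
      by (intro integrable_continuous continuous_on_subset[OF that ab])
    have "integral (cbox a b) (\<lambda>x. Z x * \<alpha> x) = integral (cbox a b) (\<lambda>x. (V' x + Y' x) - Q x)"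
    proof (rule integral_cong)
      fix x assume "x \<in> cbox a b"
      then have "U (x $ 1) \<noteq> 0" "F (x $ 1) \<noteq> 0" using nzJ ab in_J by blast+
      then show "Z x * \<alpha> x = (V' x + Y' x) - Q x"
        unfolding Z_def V'_def Y'_def Q_def p_def by (simp add: field_simps)
    qed
    also have "\<dots> = 0"
      using integral_diff[OF integrable_add[OF int[OF cV(2)] int[OF cV(4)]] int[OF cQ]]
        integral_add[OF int[OF cV(2)] int[OF cV(4)]] iV iY iQ by simp
    finally show "integral (cbox a b) (\<lambda>x. Z x * \<alpha> x) = 0" .
  qed
  then show ?thesis using w_pos[OF \<open>r \<in> J\<close>] by (simp add: Z_def x0(2))
qed

text \<open>Twice the mean curvature vector equals the tension field \<open>T e + W \<partial>\<^sub>h\<close>: removing the component tangent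
  to the profile curve from the trace of the second derivatives amounts to the term \<open>drift\<close> in \<open>T\<close> and \<open>W\<close>.
  The first flat coordinate of \<open>e\<close> is \<open>sinh k \<noteq> 0\<close>, so that coordinate alone decides whether \<open>T = 0\<close>.\<close>

lemma minimal_imp_radial_tension_0:
  assumes "minimal_on D (rotation_surface k h)" "r \<in> J"
  shows "T r = 0"
proof -
  obtain x where x: "x \<in> D" "r = x $ 1" using assms(2) by (auto simp: J_def)
  let ?\<psi> = "rotation_surface k h"
  have K1: "\<forall>y\<in>D. has_partial_deriv 1 (\<lambda>x. k (x $ 1)) (k1 (y $ 1)) y"
    and H1: "\<forall>y\<in>D. has_partial_deriv 1 (\<lambda>x. h (x $ 1)) (h1 (y $ 1)) y"
    using has_partial_deriv_coord[OF derivs(1)[OF in_J]] has_partial_deriv_coord[OF derivs(3)[OF in_J]] by blast+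
  have other: "has_partial_deriv 2 (\<lambda>x::real^2. f (x $ 1)) 0 y" for f :: "real \<Rightarrow> real" and y
    by (rule has_partial_deriv_coord_other) simp
  have K2: "\<forall>y\<in>D. has_partial_deriv 2 (\<lambda>x. k (x $ 1)) ((\<lambda>_. 0) y) y"
    and H2: "\<forall>y\<in>D. has_partial_deriv 2 (\<lambda>x. h (x $ 1)) 0 y" using other by blast+
  note d = polar_map_derivs[OF D_open x(1) K1 K2 H1 H2 has_partial_deriv_coord[OF derivs(2)[OF in_J[OF x(1)]]]
      has_partial_deriv_const has_partial_deriv_coord[OF derivs(4)[OF in_J[OF x(1)]]],
      folded rotation_surface_eq_polar_map, folded x(2)]
  have nz: "U r \<noteq> 0" "F r \<noteq> 0" "sinh (k r) \<noteq> 0" using profile_pos[OF assms(2)] by (auto simp: F_def)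
  have CS: "cosh (k r) * cosh (k r) = 1 + sinh (k r) * sinh (k r)" by (rule cosh_sq_real)
  have cs: "cos (x $ 2) * cos (x $ 2) = 1 - sin (x $ 2) * sin (x $ 2)" by (rule cos_sq_real)
  define rad where "rad a b = ambient (sinh (k r) * a) (cosh (k r) * a * cos (x $ 2)) (cosh (k r) * a * sin (x $ 2)) b"
    for a b
  define ang where "ang = ambient 0 (- (sinh (k r) * sin (x $ 2))) (sinh (k r) * cos (x $ 2)) 0"
  have p: "partial_deriv 1 ?\<psi> x = rad (k1 r) (h1 r)" "partial_deriv 2 ?\<psi> x = ang"
    and c: "cov_deriv ?\<psi> 1 (partial_deriv 1 ?\<psi>) x = rad (k2 r) (h2 r)"
      "cov_deriv ?\<psi> 2 (partial_deriv 2 ?\<psi>) x = rad (- (sinh (k r) * cosh (k r))) 0"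
    using d by (simp_all add: rad_def ang_def)
  have ips: "ip (rad a a') (rad b b') = a * b + a' * b'" "ip (rad a a') ang = 0" for a b a' b'
  proof -
    show "ip (rad a a') (rad b b') = a * b + a' * b'"
      unfolding rad_def ip_ambient using CS cs by algebra
    show "ip (rad a a') ang = 0" by (simp add: rad_def ang_def ip_ambient)
  qed
  have fst_rad: "fst (rad a b) $ 1 = sinh (k r) * a" for a b
    by (simp add: rad_def ambient_def)
  have "mean_curvature_vector ?\<psi> x = 0" using assms(1) x(1) by (simp add: minimal_on_def)
  then have "fst (mean_curvature_vector ?\<psi> x) $ 1 = 0" by simp
  moreover have "fst (mean_curvature_vector ?\<psi> x) $ 1 = 1/2 * (sinh (k r) * T r)"
  proof -
    have "fst (mean_curvature_vector ?\<psi> x) $ 1 = 1/2 * (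
        1 / U r * (sinh (k r) * k2 r - 1 / U r * (k2 r * k1 r + h2 r * h1 r) * (sinh (k r) * k1 r))
        + 1 / F r * (sinh (k r) * (- (sinh (k r) * cosh (k r)))
            - 1 / U r * (- (sinh (k r) * cosh (k r)) * k1 r) * (sinh (k r) * k1 r)))"
      by (simp add: mean_curvature_vector_def second_fundamental_form_def sum_2 inv_metric[OF x(1)]
          x(2)[symmetric] p c ips fst_rad)
    also have "\<dots> = 1/2 * (sinh (k r) * T r)"
      using nz by (simp add: T_def drift_def U1_def F1_def F_def field_simps power2_eq_square)
    finally show ?thesis .
  qed
  ultimately show ?thesis using nz by simp
qed

end

section \<open>Unsolvability of the radial equation\<close>

lemma coth_derivs:
  fixes r :: real
  assumes "sinh r \<noteq> 0"
  shows "((\<lambda>r. - cosh r / sinh r) has_real_derivative 1 / (sinh r)^2) (at r)"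
    and "((\<lambda>r. 1 / (sinh r)^2) has_real_derivative - 2 * cosh r / (sinh r)^3) (at r)"
  using assms cosh_sq_real[of r]
  by (auto intro!: derivative_eq_intros simp: field_simps power2_eq_square power3_eq_cube)

lemma inverse_sinh_cosh_cubed_derivs:
  fixes r :: real
  assumes "sinh r \<noteq> 0"
  shows "((\<lambda>r. 1 / (sinh r * (cosh r)^3)) has_real_derivative
      - (1 + 4 * (sinh r)^2) / ((sinh r)^2 * (cosh r)^4)) (at r)"
    and "((\<lambda>r. - (1 + 4 * (sinh r)^2) / ((sinh r)^2 * (cosh r)^4)) has_real_derivative
      2 * (1 + 3 * (sinh r)^2 + 8 * (sinh r)^4) / ((sinh r)^3 * (cosh r)^5)) (at r)"
proof -
  let ?S = "sinh r" and ?C = "cosh r"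
  have C: "?C \<noteq> 0" using cosh_real_pos[of r] by simp
  have CS: "?C * ?C = 1 + ?S * ?S" by (rule cosh_sq_real)
  have "((\<lambda>r. 1 / (sinh r * (cosh r)^3)) has_real_derivative
      - (?C * ?C^3 + ?S * (3 * ?C^2 * ?S)) / ((?S * ?C^3) * (?S * ?C^3))) (at r)"
    using assms C by (auto intro!: derivative_eq_intros)
  also have "- (?C * ?C^3 + ?S * (3 * ?C^2 * ?S)) / ((?S * ?C^3) * (?S * ?C^3))
      = - (1 + 4 * ?S^2) / (?S^2 * ?C^4)"
  proof (subst frac_eq_eq)
    show "- (?C * ?C^3 + ?S * (3 * ?C^2 * ?S)) * (?S^2 * ?C^4) = - (1 + 4 * ?S^2) * ((?S * ?C^3) * (?S * ?C^3))"
      using CS by algebra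
  qed (use assms C in auto)
  finally show "((\<lambda>r. 1 / (sinh r * (cosh r)^3)) has_real_derivative
      - (1 + 4 * ?S^2) / (?S^2 * ?C^4)) (at r)" .
  have "((\<lambda>r. - (1 + 4 * (sinh r)^2) / ((sinh r)^2 * (cosh r)^4)) has_real_derivative
      (- (8 * ?S * ?C) * (?S^2 * ?C^4) + (1 + 4 * ?S^2) * (2 * ?S * ?C * ?C^4 + ?S^2 * (4 * ?C^3 * ?S)))
        / ((?S^2 * ?C^4) * (?S^2 * ?C^4))) (at r)"
    using assms C by (auto intro!: derivative_eq_intros simp: algebra_simps)
  also have "(- (8 * ?S * ?C) * (?S^2 * ?C^4) + (1 + 4 * ?S^2) * (2 * ?S * ?C * ?C^4 + ?S^2 * (4 * ?C^3 * ?S)))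
        / ((?S^2 * ?C^4) * (?S^2 * ?C^4)) = 2 * (1 + 3 * ?S^2 + 8 * ?S^4) / (?S^3 * ?C^5)"
  proof (subst frac_eq_eq)
    show "(- (8 * ?S * ?C) * (?S^2 * ?C^4) + (1 + 4 * ?S^2) * (2 * ?S * ?C * ?C^4 + ?S^2 * (4 * ?C^3 * ?S)))
        * (?S^3 * ?C^5) = 2 * (1 + 3 * ?S^2 + 8 * ?S^4) * ((?S^2 * ?C^4) * (?S^2 * ?C^4))"
      using CS by algebra
  qed (use assms C in auto)
  finally show "((\<lambda>r. - (1 + 4 * (sinh r)^2) / ((sinh r)^2 * (cosh r)^4)) has_real_derivative
      2 * (1 + 3 * ?S^2 + 8 * ?S^4) / (?S^3 * ?C^5)) (at r)" .
qed

context rotation_immersion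
begin

text \<open>The equation \<open>\<Delta>T = cosh (2 k) / sinh\<^sup>2 k * T\<close>. The derivatives of \<open>T\<close> are quantified over because
  each of the two curvature conditions supplies an explicit formula for them.\<close>

definition radial_biharmonic :: bool where
  "radial_biharmonic \<longleftrightarrow> (\<forall>T1 T2. (\<forall>r\<in>J. (T has_real_derivative T1 r) (at r))
    \<longrightarrow> (\<forall>r\<in>J. (T1 has_real_derivative T2 r) (at r)) \<longrightarrow> continuous_on J T2
    \<longrightarrow> (\<forall>r\<in>J. T2 r / U r - drift r * T1 r = (1 + 2 * (sinh (k r))\<^sup>2) / F r * T r))"

text \<open>Both curvature conditions lead to \<open>\<Delta>k = m / (S C\<^sup>3)\<close> with \<open>m' = 0\<close>: with \<open>m = 0\<close> when \<open>k\<close> is harmonic and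
  with \<open>m = ((sinh k)')\<^sup>2 / U\<close> when the surface is flat. Then \<open>T\<close> is a function of \<open>k\<close> up to the locally
  constant \<open>m\<close>, so \<open>\<Delta>T = T\<^sub>k \<Delta>k + T\<^sub>k\<^sub>k k'\<^sup>2 / U\<close>, and the radial equation becomes algebraic in
  \<open>S\<close>, \<open>C\<close>, \<open>m\<close> and \<open>k'\<^sup>2 / U\<close>.\<close>

lemma radial_biharmonic_imp_equation:
  assumes m: "\<And>r. r \<in> J \<Longrightarrow> (m has_real_derivative 0) (at r)"
    and T: "\<And>r. r \<in> J \<Longrightarrow> k2 r / U r - drift r * k1 r = m r / (sinh (k r) * (cosh (k r))^3)"
    and eq: radial_biharmonic
    and r: "r \<in> J"
  defines "S \<equiv> sinh (k r)" and "C \<equiv> cosh (k r)"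
  shows "m r / (S * C^3) * (1 / S^2 + m r * (- (1 + 4 * S^2) / (S^2 * C^4)))
      + (k1 r)\<^sup>2 / U r * (- 2 * C / S^3 + m r * (2 * (1 + 3 * S^2 + 8 * S^4) / (S^3 * C^5)))
    = (1 + 2 * S^2) / S^2 * (- C / S + m r / (S * C^3))"
proof -
  define T1 where "T1 r = k1 r * (1 / (sinh (k r))^2
      + m r * (- (1 + 4 * (sinh (k r))^2) / ((sinh (k r))^2 * (cosh (k r))^4)))" for r
  define Q where "Q r = - 2 * cosh (k r) / (sinh (k r))^3
      + m r * (2 * (1 + 3 * (sinh (k r))^2 + 8 * (sinh (k r))^4) / ((sinh (k r))^3 * (cosh (k r))^5))" for r
  define T2 where "T2 r = k2 r * (1 / (sinh (k r))^2
      + m r * (- (1 + 4 * (sinh (k r))^2) / ((sinh (k r))^2 * (cosh (k r))^4))) + (k1 r)\<^sup>2 * Q r" for r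
  have TJ: "T r = - cosh (k r) / sinh (k r) + m r * (1 / (sinh (k r) * (cosh (k r))^3))" if "r \<in> J" for r
    using T[OF that] by (simp add: T_def)
  have nz: "sinh (k r) \<noteq> 0" if "r \<in> J" for r using profile_pos(2)[OF that] .
  have C0: "cosh (k r) \<noteq> 0" for r using cosh_real_pos[of "k r"] by simp
  note ch = DERIV_chain2[where g=k, OF _ derivs(1)]
  have dT1: "(T has_real_derivative T1 r) (at r)" if r: "r \<in> J" for r
  proof (rule has_field_derivative_transform_within_open[OF _ open_J r TJ[symmetric]])
    have "((\<lambda>r. - cosh (k r) / sinh (k r)) has_real_derivative 1 / (sinh (k r))^2 * k1 r) (at r)"
      by (rule ch[OF coth_derivs(1)[OF nz[OF r]] r])
    moreover have "((\<lambda>r. 1 / (sinh (k r) * (cosh (k r))^3)) has_real_derivative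
        - (1 + 4 * (sinh (k r))^2) / ((sinh (k r))^2 * (cosh (k r))^4) * k1 r) (at r)"
      by (rule ch[OF inverse_sinh_cosh_cubed_derivs(1)[OF nz[OF r]] r])
    ultimately show "((\<lambda>r. - cosh (k r) / sinh (k r) + m r * (1 / (sinh (k r) * (cosh (k r))^3)))
        has_real_derivative T1 r) (at r)"
      unfolding T1_def by (intro DERIV_cong[OF DERIV_add[OF _ DERIV_mult[OF m[OF r]]]]) (simp add: algebra_simps)+
  qed
  have dT2: "(T1 has_real_derivative T2 r) (at r)" if r: "r \<in> J" for r
  proof -
    have a: "((\<lambda>r. 1 / (sinh (k r))^2) has_real_derivative - 2 * cosh (k r) / (sinh (k r))^3 * k1 r) (at r)"
      by (rule ch[OF coth_derivs(2)[OF nz[OF r]] r])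
    have b: "((\<lambda>r. - (1 + 4 * (sinh (k r))^2) / ((sinh (k r))^2 * (cosh (k r))^4)) has_real_derivative
        2 * (1 + 3 * (sinh (k r))^2 + 8 * (sinh (k r))^4) / ((sinh (k r))^3 * (cosh (k r))^5) * k1 r) (at r)"
      by (rule ch[OF inverse_sinh_cosh_cubed_derivs(2)[OF nz[OF r]] r])
    show ?thesis
      unfolding T1_def[abs_def] T2_def Q_def
      by (rule DERIV_cong[OF DERIV_mult[OF derivs(2)[OF r] DERIV_add[OF a DERIV_mult[OF m[OF r] b]]]])
         (simp add: algebra_simps power2_eq_square)
  qed
  have cm: "continuous_on J m" by (intro continuous_at_imp_continuous_on ballI DERIV_isCont[OF m])
  have cT2: "continuous_on J T2"
    unfolding T2_def[abs_def] Q_def[abs_def]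
    by (intro continuous_intros continuous_on_profile cm) (use nz C0 in auto)
  have "T2 r / U r - drift r * T1 r = (1 + 2 * S\<^sup>2) / S\<^sup>2 * T r"
    using eq[unfolded radial_biharmonic_def, rule_format, of T1 T2 r] dT1 dT2 cT2 r
    by (simp add: F_def S_def)
  moreover have "T2 r / U r - drift r * T1 r
    = (k2 r / U r - drift r * k1 r) * (1 / S^2 + m r * (- (1 + 4 * S^2) / (S^2 * C^4))) + (k1 r)\<^sup>2 / U r * Q r"
    unfolding T2_def T1_def S_def[symmetric] C_def[symmetric]
    by (simp only: add_divide_distrib left_diff_distrib times_divide_eq_left mult.assoc times_divide_eq_right mult.left_commute)
  ultimately show ?thesis
    unfolding T[OF r] TJ[OF r] Q_def S_def[symmetric] C_def[symmetric] by simp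
qed

text \<open>The algebraic equation with \<open>m = 0\<close> is \<open>2 k'\<^sup>2 = cosh (2 k) U\<close> (\<open>key\<close>). It holds on the open set \<open>J\<close>,
  so it may be differentiated (\<open>d\<close>); together with \<open>\<Delta>k = 0\<close> (\<open>e\<close>) this makes a product of positive
  quantities vanish.\<close>

lemma harmonic_profile_contradiction:
  assumes lap: "\<And>r. r \<in> J \<Longrightarrow> k2 r / U r - drift r * k1 r = 0"
    and eq: radial_biharmonic
    and r: "r \<in> J"
  shows False
proof -
  have key: "2 * (k1 r)\<^sup>2 = (1 + 2 * (sinh (k r))\<^sup>2) * U r" if r: "r \<in> J" for r
  proof -
    let ?S = "sinh (k r)" and ?C = "cosh (k r)"
    have nz: "?S \<noteq> 0" "U r \<noteq> 0" using profile_pos[OF r] by auto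
    have "(k1 r)\<^sup>2 / U r * (- 2 * ?C / ?S^3) = (1 + 2 * ?S^2) / ?S^2 * (- ?C / ?S)"
      using radial_biharmonic_imp_equation[where m="\<lambda>_. 0" and r=r] lap eq r by simp
    then have "2 * (k1 r)\<^sup>2 * ?C = (1 + 2 * ?S\<^sup>2) * U r * ?C"
      using nz by (simp add: field_simps power2_eq_square power3_eq_cube)
    then show ?thesis using cosh_real_pos[of "k r"] by simp
  qed
  let ?S = "sinh (k r)" and ?C = "cosh (k r)" and ?q = "1 + 2 * (sinh (k r))\<^sup>2"
  have C: "?C > 0" by simp
  have U: "U r > 0" and S: "?S \<noteq> 0" using profile_pos[OF r] by auto
  have q: "?q > 0" by (simp add: add_pos_nonneg)
  have k1: "(k1 r)\<^sup>2 > 0" using key[OF r] U q by (smt (verit) mult_pos_pos)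
  have "((\<lambda>r. 2 * (k1 r)\<^sup>2) has_real_derivative 4 * k1 r * k2 r) (at r)"
    by (auto intro!: derivative_eq_intros derivs(2)[OF r])
  then have "((\<lambda>r. (1 + 2 * (sinh (k r))\<^sup>2) * U r) has_real_derivative 4 * k1 r * k2 r) (at r)"
    by (rule has_field_derivative_transform_within_open[OF _ open_J r]) (rule key)
  moreover have "((\<lambda>r. (1 + 2 * (sinh (k r))\<^sup>2) * U r) has_real_derivative
      4 * ?S * ?C * k1 r * U r + ?q * U1 r) (at r)"
    by (auto intro!: derivative_eq_intros derivs(1)[OF r] derivs(5)[OF r])
  ultimately have d: "4 * k1 r * k2 r = 4 * ?S * ?C * k1 r * U r + ?q * U1 r"
    by (rule DERIV_unique)
  have e: "2 * U r * ?S * k2 r = ?S * k1 r * U1 r - 2 * ?C * (k1 r)\<^sup>2 * U r"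
    using lap[OF r] U S by (simp add: drift_def F_def F1_def field_simps power2_eq_square)
  \<comment> \<open>Multiplying \<open>e\<close> by \<open>1 + 2 S\<^sup>2\<close> and eliminating \<open>U1\<close> by \<open>d\<close>, the terms with \<open>k2\<close> cancel by \<open>key\<close>.\<close>
  have "2 * ?C * (k1 r)\<^sup>2 * U r * (2 * ?S\<^sup>2 + ?q) = 0"
    using d e key[OF r] by algebra
  moreover have "2 * ?C * (k1 r)\<^sup>2 * U r * (2 * ?S\<^sup>2 + ?q) > 0"
    using C k1 U by (intro mult_pos_pos add_nonneg_pos[OF _ q]) auto
  ultimately show False by (metis less_irrefl)
qed

text \<open>With \<open>f = sinh k\<close>, flatness is \<open>2 U f'' = U' f'\<close>, which says that \<open>m = f'\<^sup>2 / U\<close> has derivative zero.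
  Since \<open>k'\<^sup>2 / U = m / C\<^sup>2\<close>, the algebraic equation involves only \<open>S\<close>, \<open>C\<close> and \<open>m\<close>; multiplied by
  \<open>S\<^sup>3 C\<^sup>7\<close> and reduced by \<open>C\<^sup>2 = 1 + S\<^sup>2\<close> it is a sum of two squares.\<close>

lemma flat_profile_contradiction:
  assumes flat: "\<And>x. x \<in> D \<Longrightarrow> gauss_curvature (induced_metric (rotation_surface k h)) x = 0"
    and eq: radial_biharmonic
    and r: "r \<in> J"
  shows False
proof -
  define f1 where "f1 r = cosh (k r) * k1 r" for r
  define f2 where "f2 r = sinh (k r) * k1 r * k1 r + cosh (k r) * k2 r" for r
  define m where "m r = (f1 r)\<^sup>2 / U r" for r
  have df1: "(f1 has_real_derivative f2 r) (at r)" if "r \<in> J" for r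
  proof -
    have "((\<lambda>r. cosh (k r)) has_real_derivative sinh (k r) * k1 r) (at r)"
      by (auto intro!: derivative_eq_intros derivs(1)[OF that])
    from DERIV_mult[OF this derivs(2)[OF that]] show ?thesis
      unfolding f1_def[abs_def] by (rule DERIV_cong) (simp add: f2_def algebra_simps)
  qed
  have flat': "2 * U r * f2 r = U1 r * f1 r" if r: "r \<in> J" for r
  proof -
    obtain x where x: "x \<in> D" "r = x $ 1" using r by (auto simp: J_def)
    have nz: "U r > 0" "sinh (k r) \<noteq> 0" using profile_pos[OF r] by auto
    have "F1 = (\<lambda>r. 2 * sinh (k r) * f1 r)" by (simp add: fun_eq_iff F1_def f1_def)
    moreover have "((\<lambda>r. 2 * sinh (k r) * f1 r) has_real_derivative
        2 * (cosh (k r) * k1 r) * f1 r + 2 * sinh (k r) * f2 r) (at r)"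
      by (auto intro!: derivative_eq_intros derivs(1)[OF r] df1[OF r])
    moreover have "2 * (cosh (k r) * k1 r) * f1 r = 2 * (f1 r)\<^sup>2"
      by (simp add: f1_def power2_eq_square)
    ultimately have "(F1 has_real_derivative 2 * (f1 r)\<^sup>2 + 2 * sinh (k r) * f2 r) (at (x $ 1))"
      unfolding x(2)[symmetric] by (simp only:)
    from gauss_curvature_eq[OF x(1) this]
    have "- (2 * (f1 r)\<^sup>2 + 2 * sinh (k r) * f2 r) / (2 * U r) + U1 r * (2 * sinh (k r) * f1 r) / (4 * (U r)\<^sup>2)
      + (2 * sinh (k r) * f1 r)\<^sup>2 / (4 * U r * (sinh (k r))\<^sup>2) = 0"
      using flat[OF x(1)] x(2) by (simp add: F1_def F_def f1_def mult.assoc)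
    moreover have "- (2 * (f1 r)\<^sup>2 + 2 * sinh (k r) * f2 r) / (2 * U r) + U1 r * (2 * sinh (k r) * f1 r) / (4 * (U r)\<^sup>2)
      + (2 * sinh (k r) * f1 r)\<^sup>2 / (4 * U r * (sinh (k r))\<^sup>2)
      = sinh (k r) * (U1 r * f1 r - 2 * U r * f2 r) / (2 * (U r)\<^sup>2)"
      using nz by (simp add: field_simps power2_eq_square)
    ultimately show ?thesis using nz by simp
  qed
  have dm: "(m has_real_derivative 0) (at r)" if r: "r \<in> J" for r
  proof -
    have U: "U r \<noteq> 0" using profile_pos[OF r] by simp
    have "(m has_real_derivative (2 * f1 r * f2 r * U r - (f1 r)\<^sup>2 * U1 r) / (U r * U r)) (at r)"
      unfolding m_def[abs_def] using U
      by (auto intro!: derivative_eq_intros df1[OF r] derivs(5)[OF r])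
    moreover have "2 * f1 r * f2 r * U r - (f1 r)\<^sup>2 * U1 r = 0" using flat'[OF r] by algebra
    ultimately show ?thesis by simp
  qed
  have Tm: "k2 r / U r - drift r * k1 r = m r / (sinh (k r) * (cosh (k r))^3)" if r: "r \<in> J" for r
  proof -
    let ?S = "sinh (k r)" and ?C = "cosh (k r)"
    have nz: "U r \<noteq> 0" "?S \<noteq> 0" "?C \<noteq> 0" using profile_pos[OF r] cosh_real_pos[of "k r"] by auto
    have "drift r * k1 r = k1 r * U1 r / (2 * (U r)\<^sup>2) - ?C * (k1 r)\<^sup>2 / (?S * U r)"
      using nz by (simp add: drift_def F_def F1_def field_simps power2_eq_square)
    moreover have "2 * U r * (?S * (k1 r)\<^sup>2 + ?C * k2 r) = U1 r * ?C * k1 r"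
      using flat'[OF r] by (simp add: f1_def f2_def power2_eq_square mult.assoc)
    then have "k2 r / U r = k1 r * U1 r / (2 * (U r)\<^sup>2) - ?S * (k1 r)\<^sup>2 / (?C * U r)"
      using nz by (simp add: field_simps power2_eq_square)
    moreover have "?C * (k1 r)\<^sup>2 / (?S * U r) - ?S * (k1 r)\<^sup>2 / (?C * U r) = (?C * ?C - ?S * ?S) * (k1 r)\<^sup>2 / (?S * ?C * U r)"
      using nz by (simp add: field_simps)
    moreover have "m r / (?S * ?C^3) = (k1 r)\<^sup>2 / (?S * ?C * U r)"
      using nz by (simp add: m_def f1_def field_simps power2_eq_square power3_eq_cube)
    ultimately show ?thesis using cosh_sq_real[of "k r"] by simp
  qed
  let ?S = "sinh (k r)" and ?C = "cosh (k r)"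
  have nz: "U r \<noteq> 0" "?S \<noteq> 0" "?C \<noteq> 0" using profile_pos[OF r] cosh_real_pos[of "k r"] by auto
  have CS: "?C * ?C = 1 + ?S * ?S" by (rule cosh_sq_real)
  have k1: "(k1 r)\<^sup>2 / U r = m r / ?C^2"
    using nz by (simp add: m_def f1_def power_mult_distrib)
  have eq1: "m r / (?S * ?C^3) * (1 / ?S^2 + m r * (- (1 + 4 * ?S^2) / (?S^2 * ?C^4)))
      + m r / ?C^2 * (- 2 * ?C / ?S^3 + m r * (2 * (1 + 3 * ?S^2 + 8 * ?S^4) / (?S^3 * ?C^5)))
    = (1 + 2 * ?S^2) / ?S^2 * (- ?C / ?S + m r / (?S * ?C^3))"
    using radial_biharmonic_imp_equation[where m=m and r=r] dm Tm eq r unfolding k1 by blast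
  have l: "(m r / (?S * ?C^3) * (1 / ?S^2 + m r * (- (1 + 4 * ?S^2) / (?S^2 * ?C^4)))
      + m r / ?C^2 * (- 2 * ?C / ?S^3 + m r * (2 * (1 + 3 * ?S^2 + 8 * ?S^4) / (?S^3 * ?C^5)))) * (?S^3 * ?C^7)
    = m r * (?C^4 - m r * (1 + 4 * ?S^2)) + m r * (- 2 * ?C^6 + 2 * m r * (1 + 3 * ?S^2 + 8 * ?S^4))"
    using nz by (simp add: field_simps eval_nat_numeral)
  have rr: "((1 + 2 * ?S^2) / ?S^2 * (- ?C / ?S + m r / (?S * ?C^3))) * (?S^3 * ?C^7)
    = (1 + 2 * ?S^2) * (- (?C^8) + m r * ?C^4)"
    using nz by (simp add: field_simps eval_nat_numeral)
  have "m r * (?C^4 - m r * (1 + 4 * ?S^2)) + m r * (- 2 * ?C^6 + 2 * m r * (1 + 3 * ?S^2 + 8 * ?S^4))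
    = (1 + 2 * ?S^2) * (- (?C^8) + m r * ?C^4)"
    using eq1 l rr by simp
  then have sos: "(1 + 2 * ?S^2) * (?C^4 - m r)^2 + 16 * (m r * ?S^2)^2 = 0"
    using CS by algebra
  have "(1 + 2 * ?S^2) * (?C^4 - m r)^2 \<ge> 0" "16 * (m r * ?S^2)^2 \<ge> 0"
    by (auto intro!: mult_nonneg_nonneg add_nonneg_nonneg)
  with sos have "(1 + 2 * ?S^2) * (?C^4 - m r)^2 = 0" "m r * ?S^2 = 0"
    by (smt (verit) zero_eq_power2 mult_eq_0_iff)+
  moreover have "1 + 2 * ?S^2 > 0" by (simp add: add_pos_nonneg)
  ultimately show False using nz by simp
qed

end

theorem theorem5p6:
  fixes k h :: "real \<Rightarrow> real" and D :: "(real^2) set"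
  assumes "open D"
    and "smooth_on ((\<lambda>x. x $ 1) ` D) k" and "smooth_on ((\<lambda>x. x $ 1) ` D) h"
    and "immersion_on D (rotation_surface k h)"
    and "(\<forall>x\<in>D. laplacian (induced_metric (rotation_surface k h)) (\<lambda>x. k (x $ 1)) x = 0)
       \<or> (\<forall>x\<in>D. gauss_curvature (induced_metric (rotation_surface k h)) x = 0)"
  shows "biharmonic_on D (induced_metric (rotation_surface k h)) (rotation_surface k h) \<longleftrightarrow> minimal_on D (rotation_surface k h)"
proof (cases "D = {}")
  case True
  then have "biharmonic_on D (induced_metric (rotation_surface k h)) (rotation_surface k h)"
    using assms(4)
    by (auto simp: biharmonic_on_def immersion_on_def compact_variation_def bienergy_def set_lebesgue_integral_def)
  with True show ?thesis by (simp add: minimal_on_def)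
next
  case False
  interpret rotation_immersion k h D by unfold_locales (rule assms)+
  obtain r where r: "r \<in> J" using False by (auto simp: J_def)
  have contra: False if radial_biharmonic
    using assms(5)
  proof
    assume "\<forall>x\<in>D. laplacian (induced_metric (rotation_surface k h)) (\<lambda>x. k (x $ 1)) x = 0"
    then have "k2 r / U r - drift r * k1 r = 0" if "r \<in> J" for r
      using that laplacian_k by (auto simp: J_def)
    then show False using harmonic_profile_contradiction[OF _ that r] by blast
  next
    assume "\<forall>x\<in>D. gauss_curvature (induced_metric (rotation_surface k h)) x = 0"
    then show False using flat_profile_contradiction[OF _ that r] by blast
  qed
  have "\<not> biharmonic_on D (induced_metric (rotation_surface k h)) (rotation_surface k h)"
    proof
    assume "biharmonic_on D (induced_metric (rotation_surface k h)) (rotation_surface k h)"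
    then have radial_biharmonic
      unfolding radial_biharmonic_def using biharmonic_radial_equation by simp
    then show False by (rule contra)
  qed
  moreover have "\<not> minimal_on D (rotation_surface k h)"
  proof
    assume min: "minimal_on D (rotation_surface k h)"
    have deriv_of_zero: "f1 r = 0" if "\<And>r. r \<in> J \<Longrightarrow> (f has_real_derivative f1 r) (at r)"
      "\<And>r. r \<in> J \<Longrightarrow> f r = 0" "r \<in> J" for f f1 :: "real \<Rightarrow> real" and r
    proof -
      have "((\<lambda>_. 0) has_real_derivative f1 r) (at r)"
        by (rule has_field_derivative_transform_within_open[OF that(1)[OF that(3)] open_J that(3) that(2)])
      then show ?thesis by (rule DERIV_unique[OF _ DERIV_const])
    qed
    have radial_biharmonic
      unfolding radial_biharmonic_def
    proof (intro allI impI ballI)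
      fix T1 T2 r
      assume T1: "\<forall>r\<in>J. (T has_real_derivative T1 r) (at r)"
        and T2: "\<forall>r\<in>J. (T1 has_real_derivative T2 r) (at r)" and r: "r \<in> J"
      have T0: "T r = 0" if "r \<in> J" for r using minimal_imp_radial_tension_0[OF min that] .
      have T10: "T1 r = 0" if "r \<in> J" for r using deriv_of_zero[of T T1 r] T1 T0 that by blast
      have "T2 r = 0" using deriv_of_zero[of T1 T2 r] T2 T10 r by blast
      with T0[OF r] T10[OF r] show "T2 r / U r - drift r * T1 r = (1 + 2 * (sinh (k r))\<^sup>2) / F r * T r"
        by simp
    qed
    then show False by (rule contra)
  qed
  ultimately show ?thesis by simp
qed

end
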